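(* Let $n$ be a positive integer, let $\lambda$ be a partition of $n$, and let $T$ be a standard $\lambda$-tableau. For $i=1,\dots,n$ let $c_i=c_i(T)$ be the content of the cell of $T$ occupied by $i$. Let $u_1,\dots,u_n$ be complex variables and consider the rational function with values in $\mathbb{C}[\mathfrak{S}_n]$ $$\Phi(u_1,\dots,u_n)=\prod_{1\leqslant i<j\leqslant n}^{\longrightarrow}\left(1-\frac{(i\,j)}{u_i-u_j}\right),$$ where the factors are written from left to right in the order in which $(i_1,j_1)$ precedes $(i_2,j_2)$ if $j_1<j_2$, or $j_1=j_2$ and $i_1<i_2$. Then the consecutive evaluations $$\Phi(u_1,\dots,u_n)\big|_{u_1=c_1}\big|_{u_2=c_2}\cdots\big|_{u_n=c_n}$$ are well-defined, and the resulting value in $\mathbb{C}[\mathfrak{S}_n]$ coincides with the diagonal matrix element $$\Phi_T=\sum_{s\in\mathfrak{S}_n}(s\cdot v_T,v_T)\,s^{-1},$$ where $v_T$ is the vector of the orthonormal Young basis of the irreducible representation $V_\lambda$ of $\mathfrak{S}_n$ corresponding to $T$.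
   Context: $\mathfrak{S}_n$ is the symmetric group on $\{1,\dots,n\}$, $\mathbb{C}[\mathfrak{S}_n]$ is its group algebra, and $(i\,j)$ denotes the transposition of $i$ and $j$. A partition $\lambda=(\lambda_1\geqslant\dots\geqslant\lambda_l\geqslant 0)$ of $n$ is identified with its diagram, a left-justified array of rows of cells with $\lambda_1$ cells in the top row, $\lambda_2$ cells in the next row, etc. A $\lambda$-tableau is a bijective filling of the cells of $\lambda$ with the numbers $1,\dots,n$; it is standard if its entries strictly increase along the rows (left to right) and down the columns. The content of the cell in row $i$ and column $j$ is $j-i$; $c_k(T)$ is the content of the cell of $T$ occupied by $k$. $V_\lambda$ is the irreducible complex representation of $\mathfrak{S}_n$ associated with $\lambda$, equipped with an $\mathfrak{S}_n$-invariant inner product $(\ ,\ )$. Its orthonormal Young basis $\{v_T\}$ is indexed by the standard $\lambda$-tableaux $T$, and the generators $s_i=(i,i+1)$, $1\leqslant i\leqslant n-1$, act by $$s_i\cdot v_T=d\,v_T+\sqrt{1-d^2}\;v_{s_iT},\qquad d=\frac{1}{c_{i+1}(T)-c_i(T)},$$ where $s_iT$ is obtained from $T$ by swapping the entries $i$ and $i+1$, and $v_{s_iT}=0$ if $s_iT$ is not standard. Consecutive evaluation means: first set $u_1=c_1$ in $\Phi$, obtaining a rational function in $u_2,\dots,u_n$ with values in $\mathbb{C}[\mathfrak{S}_n]$; then set $u_2=c_2$ in that rational function, obtaining a rational function in $u_3,\dots,u_n$; and so on up to $u_n=c_n$. At each step the current function is regarded as a rational function (with common factors cancelled) in the remaining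 variables. The evaluations are well-defined if at each step $k$ the rational function in $u_k,\dots,u_n$ obtained from the previous steps is regular at $u_k=c_k$, that is, it has no pole along $u_k=c_k$, so that the substitution $u_k=c_k$ yields a rational function in $u_{k+1},\dots,u_n$ (an element of $\mathbb{C}[\mathfrak{S}_n]$ when $k=n$). *)

theory Defs
  imports
    Complex_Main
    "HOL-Library.Poly_Mapping"
    "HOL-Computational_Algebra.Fraction_Field"
    "HOL-Combinatorics.Permutations"
begin

section \<open>Partitions, standard tableaux, contents\<close>

definition partition_of :: "nat \<Rightarrow> nat list \<Rightarrow> bool" where
  "partition_of n lam \<longleftrightarrow> sorted_wrt (\<ge>) lam \<and> sum_list lam = n"

text \<open>Cells are pairs (row, column), both counted from 1.\<close>

definition diagram :: "nat list \<Rightarrow> (nat \<times> nat) set" where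
  "diagram lam = {(i, j). 1 \<le> i \<and> i \<le> length lam \<and> 1 \<le> j \<and> j \<le> lam ! (i - 1)}"

text \<open>Fillings are normalised to be 0 outside the diagram, so that equality of functions is
  equality of tableaux.\<close>

definition tableau :: "nat list \<Rightarrow> (nat \<times> nat \<Rightarrow> nat) \<Rightarrow> bool" where
  "tableau lam T \<longleftrightarrow>
     bij_betw T (diagram lam) {1..sum_list lam} \<and> (\<forall>x. x \<notin> diagram lam \<longrightarrow> T x = 0)"

definition standard_tableau :: "nat list \<Rightarrow> (nat \<times> nat \<Rightarrow> nat) \<Rightarrow> bool" where
  "standard_tableau lam T \<longleftrightarrow> tableau lam T \<and>
     (\<forall>i j j'. (i, j) \<in> diagram lam \<and> (i, j') \<in> diagram lam \<and> j < j' \<longrightarrow> T (i, j) < T (i, j')) \<and>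
     (\<forall>i i' j. (i, j) \<in> diagram lam \<and> (i', j) \<in> diagram lam \<and> i < i' \<longrightarrow> T (i, j) < T (i', j))"

definition cell_content :: "nat \<times> nat \<Rightarrow> int" where
  "cell_content x = int (snd x) - int (fst x)"

definition content :: "nat list \<Rightarrow> (nat \<times> nat \<Rightarrow> nat) \<Rightarrow> nat \<Rightarrow> int" where
  "content lam T k = cell_content (the_inv_into (diagram lam) T k)"

definition swap_entries :: "nat \<Rightarrow> (nat \<times> nat \<Rightarrow> nat) \<Rightarrow> (nat \<times> nat \<Rightarrow> nat)" where
  "swap_entries i T = transpose i (i + 1) \<circ> T"


section \<open>The representation and its Young basis\<close>

text \<open>Elements of the symmetric group on \<open>{1..n}\<close> are the functions \<open>s\<close> with
  \<open>s permutes {1..n}\<close>, multiplied by composition. A representation lives on a subspace \<open>V\<close> of an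
  arbitrary complex vector space.\<close>

locale sym_rep = vector_space scale
  for scale :: "complex \<Rightarrow> 'v::ab_group_add \<Rightarrow> 'v" +
  fixes n :: nat
    and V :: "'v set"
    and act :: "(nat \<Rightarrow> nat) \<Rightarrow> 'v \<Rightarrow> 'v"
  assumes subspace_V: "subspace V"
    and act_in: "\<lbrakk>s permutes {1..n}; x \<in> V\<rbrakk> \<Longrightarrow> act s x \<in> V"
    and act_add: "\<lbrakk>s permutes {1..n}; x \<in> V; y \<in> V\<rbrakk> \<Longrightarrow> act s (x + y) = act s x + act s y"
    and act_scale: "\<lbrakk>s permutes {1..n}; x \<in> V\<rbrakk> \<Longrightarrow> act s (scale a x) = scale a (act s x)"
    and act_id: "x \<in> V \<Longrightarrow> act id x = x"
    and act_comp: "\<lbrakk>s permutes {1..n}; t permutes {1..n}; x \<in> V\<rbrakk>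
                     \<Longrightarrow> act (s \<circ> t) x = act s (act t x)"

locale irreducible_sym_rep = sym_rep scale n V act
  for scale :: "complex \<Rightarrow> 'v::ab_group_add \<Rightarrow> 'v" and n V act +
  assumes nonzero: "V \<noteq> {0}"
    and irreducible: "\<lbrakk>subspace W; W \<subseteq> V; \<And>s x. \<lbrakk>s permutes {1..n}; x \<in> W\<rbrakk> \<Longrightarrow> act s x \<in> W\<rbrakk>
                        \<Longrightarrow> W = {0} \<or> W = V"

locale unitary_sym_rep = sym_rep scale n V act
  for scale :: "complex \<Rightarrow> 'v::ab_group_add \<Rightarrow> 'v" and n V act +
  fixes ip :: "'v \<Rightarrow> 'v \<Rightarrow> complex"
  assumes ip_add: "\<lbrakk>x \<in> V; y \<in> V; z \<in> V\<rbrakk> \<Longrightarrow> ip (x + y) z = ip x z + ip y z"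
    and ip_scale: "\<lbrakk>x \<in> V; y \<in> V\<rbrakk> \<Longrightarrow> ip (scale a x) y = a * ip x y"
    and ip_cnj: "\<lbrakk>x \<in> V; y \<in> V\<rbrakk> \<Longrightarrow> ip y x = cnj (ip x y)"
    and ip_pos: "\<lbrakk>x \<in> V; x \<noteq> 0\<rbrakk> \<Longrightarrow> Re (ip x x) > 0"
    and ip_invariant: "\<lbrakk>s permutes {1..n}; x \<in> V; y \<in> V\<rbrakk> \<Longrightarrow> ip (act s x) (act s y) = ip x y"

text \<open>The irreducible representation associated with \<open>lam\<close>, with invariant inner product \<open>ip\<close> and
  orthonormal Young basis \<open>v\<close>. Young's formulas determine the representation up to
  isomorphism. The value of \<open>v\<close> at non-standard fillings is irrelevant.\<close>

locale young_rep = irreducible_sym_rep scale n V act + unitary_sym_rep scale n V act ip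
  for scale :: "complex \<Rightarrow> 'v::ab_group_add \<Rightarrow> 'v" and n V act ip +
  fixes lam :: "nat list"
    and v :: "(nat \<times> nat \<Rightarrow> nat) \<Rightarrow> 'v"
  assumes partition: "partition_of n lam"
    and basis_in: "standard_tableau lam T \<Longrightarrow> v T \<in> V"
    and basis_orthonormal: "\<lbrakk>standard_tableau lam T; standard_tableau lam T'\<rbrakk>
                              \<Longrightarrow> ip (v T) (v T') = (if T = T' then 1 else 0)"
    and basis_span: "span (v ` {T. standard_tableau lam T}) = V"
    and young_formula:
      "\<lbrakk>standard_tableau lam T; 1 \<le> i; i + 1 \<le> n;
        d = 1 / real_of_int (content lam T (i + 1) - content lam T i)\<rbrakk>
       \<Longrightarrow> act (transpose i (i + 1)) (v T) =
            scale (of_real d) (v T) +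
            scale (of_real (sqrt (1 - d\<^sup>2)))
              (if standard_tableau lam (swap_entries i T) then v (swap_entries i T) else 0)"


section \<open>The group algebra\<close>

text \<open>An element of the group algebra over \<open>'a\<close> is its coefficient function, which vanishes
  off the permutations of \<open>{1..n}\<close>. The basis element \<open>s\<close> is \<open>ga_basis s\<close>; in particular
  \<open>ga_basis id\<close> is the unit.\<close>

type_synonym 'a group_alg = "(nat \<Rightarrow> nat) \<Rightarrow> 'a"

definition ga_basis :: "(nat \<Rightarrow> nat) \<Rightarrow> 'a::comm_ring_1 group_alg" where
  "ga_basis s = (\<lambda>t. if t = s then 1 else 0)"

definition ga_mult :: "nat \<Rightarrow> 'a::comm_ring_1 group_alg \<Rightarrow> 'a group_alg \<Rightarrow> 'a group_alg" where
  "ga_mult n f g =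
     (\<lambda>s. \<Sum>(a, b) \<in> {(a, b). a permutes {1..n} \<and> b permutes {1..n} \<and> a \<circ> b = s}. f a * g b)"

definition ga_prod_list :: "nat \<Rightarrow> 'a::comm_ring_1 group_alg list \<Rightarrow> 'a group_alg" where
  "ga_prod_list n fs = foldr (ga_mult n) fs (ga_basis id)"


section \<open>Rational functions and their evaluation\<close>

text \<open>Polynomials and rational functions over the complex numbers in the variables
  \<open>u\<^sub>0, u\<^sub>1, u\<^sub>2, \<dots>\<close>. Monomials are finitely supported exponent functions.\<close>

type_synonym cpoly = "(nat \<Rightarrow>\<^sub>0 nat) \<Rightarrow>\<^sub>0 complex"
type_synonym ratfun = "cpoly fract"

definition rconst :: "complex \<Rightarrow> ratfun" where
  "rconst a = Fract (Poly_Mapping.single 0 a) 1"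

definition rvar :: "nat \<Rightarrow> ratfun" where
  "rvar i = Fract (Poly_Mapping.single (Poly_Mapping.single i 1) 1) 1"

text \<open>\<open>poly_subst k c p\<close> substitutes the number \<open>c\<close> for the variable \<open>u\<^sub>k\<close> in \<open>p\<close>.\<close>

definition poly_subst :: "nat \<Rightarrow> complex \<Rightarrow> cpoly \<Rightarrow> cpoly" where
  "poly_subst k c p =
     (\<Sum>m \<in> Poly_Mapping.keys p.
        Poly_Mapping.single (Poly_Mapping.update k 0 m)
          (Poly_Mapping.lookup p m * c ^ Poly_Mapping.lookup m k))"

text \<open>A rational function is regular along the hyperplane \<open>u\<^sub>k = c\<close> if it is a quotient of
  polynomials whose denominator does not vanish identically there. As the polynomial ring is
  factorial, this says that \<open>u\<^sub>k - c\<close> does not divide the denominator in lowest terms.\<close>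

definition regular_at :: "nat \<Rightarrow> complex \<Rightarrow> ratfun \<Rightarrow> bool" where
  "regular_at k c r \<longleftrightarrow> (\<exists>p q. poly_subst k c q \<noteq> 0 \<and> r = Fract p q)"

definition eval_at :: "nat \<Rightarrow> complex \<Rightarrow> ratfun \<Rightarrow> ratfun" where
  "eval_at k c r = (THE w. \<exists>p q. poly_subst k c q \<noteq> 0 \<and> r = Fract p q \<and>
                                  w = Fract (poly_subst k c p) (poly_subst k c q))"

text \<open>The value does not depend on the chosen quotient, so \<^term>\<open>eval_at\<close> is meaningful on
  regular functions (lemma \<open>eval_at_Fract\<close>).\<close>

lemma poly_subst_superset:
  assumes "finite A" "Poly_Mapping.keys p \<subseteq> A"
  shows "poly_subst k c p =
     (\<Sum>m \<in> A. Poly_Mapping.single (Poly_Mapping.update k 0 m)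
          (Poly_Mapping.lookup p m * c ^ Poly_Mapping.lookup m k))"
  unfolding poly_subst_def
  by (rule sum.mono_neutral_left) (use assms in \<open>auto simp: in_keys_iff\<close>)

lemma poly_subst_add: "poly_subst k c (p + q) = poly_subst k c p + poly_subst k c q"
proof -
  let ?A = "Poly_Mapping.keys p \<union> Poly_Mapping.keys q"
  show ?thesis
    using Poly_Mapping.keys_add[of p q]
    by (simp add: poly_subst_superset[of ?A] lookup_add algebra_simps single_add sum.distrib)
qed

lemma poly_subst_single:
  "poly_subst k c (Poly_Mapping.single m a) =
     Poly_Mapping.single (Poly_Mapping.update k 0 m) (a * c ^ Poly_Mapping.lookup m k)"
  by (subst poly_subst_superset[of "{m}"]) (auto simp: lookup_single)

lemma poly_subst_sum: "poly_subst k c (sum f A) = (\<Sum>x\<in>A. poly_subst k c (f x))"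
proof -
  have "poly_subst k c 0 = 0"
    by (simp add: poly_subst_def)
  then show ?thesis
    by (induction A rule: infinite_finite_induct) (simp_all add: poly_subst_add)
qed

lemma cpoly_sum_single:
  "p = (\<Sum>m \<in> Poly_Mapping.keys p. Poly_Mapping.single m (Poly_Mapping.lookup p m))"
  for p :: cpoly
  by (rule poly_mapping_eqI) (auto simp: lookup_sum lookup_single when_def in_keys_iff)

lemma poly_subst_mult: "poly_subst k c (p * q) = poly_subst k c p * poly_subst k c q"
proof -
  have upd: "Poly_Mapping.update k 0 (m + m') =
      Poly_Mapping.update k 0 m + Poly_Mapping.update k 0 m'" for m m' :: "nat \<Rightarrow>\<^sub>0 nat"
    by (rule poly_mapping_eqI) (simp add: lookup_update lookup_add)
  have single: "poly_subst k c (Poly_Mapping.single m a * Poly_Mapping.single m' b) =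
      poly_subst k c (Poly_Mapping.single m a) * poly_subst k c (Poly_Mapping.single m' b)"
    for m m' a b
    by (simp add: mult_single poly_subst_single upd lookup_add power_add mult_ac)
  have "poly_subst k c ((\<Sum>m\<in>A. Poly_Mapping.single m (f m)) * (\<Sum>m\<in>B. Poly_Mapping.single m (g m))) =
      poly_subst k c (\<Sum>m\<in>A. Poly_Mapping.single m (f m)) *
      poly_subst k c (\<Sum>m\<in>B. Poly_Mapping.single m (g m))" for A B f g
    by (simp add: sum_product poly_subst_sum single)
  then show ?thesis
    by (metis cpoly_sum_single)
qed

lemma poly_subst_zero: "poly_subst k c 0 = 0"
  by (simp add: poly_subst_def)

lemma eval_at_Fract:
  assumes "poly_subst k c q \<noteq> 0"
  shows "eval_at k c (Fract p q) = Fract (poly_subst k c p) (poly_subst k c q)"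
  unfolding eval_at_def
proof (rule the_equality)
  fix w
  assume "\<exists>p' q'. poly_subst k c q' \<noteq> 0 \<and> Fract p q = Fract p' q' \<and>
            w = Fract (poly_subst k c p') (poly_subst k c q')"
  then obtain p' q' where q': "poly_subst k c q' \<noteq> 0" and eq: "Fract p q = Fract p' q'"
    and w: "w = Fract (poly_subst k c p') (poly_subst k c q')"
    by blast
  have "q \<noteq> 0" "q' \<noteq> 0"
    using assms q' poly_subst_zero by metis+
  then have "p * q' = p' * q"
    using eq by (simp add: eq_fract)
  then have "poly_subst k c p * poly_subst k c q' = poly_subst k c p' * poly_subst k c q"
    by (metis poly_subst_mult)
  then show "w = Fract (poly_subst k c p) (poly_subst k c q)"
    using assms q' w by (simp add: eq_fract)
qed (use assms in blast)


section \<open>Consecutive evaluation of the fusion product\<close>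

text \<open>Regularity and evaluation of rational functions with values in the group algebra are
  coefficientwise.\<close>

definition ga_regular_at :: "nat \<Rightarrow> complex \<Rightarrow> ratfun group_alg \<Rightarrow> bool" where
  "ga_regular_at k c F \<longleftrightarrow> (\<forall>s. regular_at k c (F s))"

definition ga_eval_at :: "nat \<Rightarrow> complex \<Rightarrow> ratfun group_alg \<Rightarrow> ratfun group_alg" where
  "ga_eval_at k c F = (\<lambda>s. eval_at k c (F s))"

fun consecutive_eval :: "(nat \<Rightarrow> complex) \<Rightarrow> ratfun group_alg \<Rightarrow> nat \<Rightarrow> ratfun group_alg" where
  "consecutive_eval c F 0 = F"
| "consecutive_eval c F (Suc k) = ga_eval_at (Suc k) (c (Suc k)) (consecutive_eval c F k)"

definition consecutive_eval_well_defined ::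
    "nat \<Rightarrow> (nat \<Rightarrow> complex) \<Rightarrow> ratfun group_alg \<Rightarrow> bool" where
  "consecutive_eval_well_defined n c F \<longleftrightarrow>
     (\<forall>k\<in>{1..n}. ga_regular_at k (c k) (consecutive_eval c F (k - 1)))"

definition fusion_factor :: "nat \<Rightarrow> nat \<Rightarrow> ratfun group_alg" where
  "fusion_factor i j =
     (\<lambda>s. ga_basis id s - 1 / (rvar i - rvar j) * ga_basis (transpose i j) s)"

text \<open>In the list comprehension \<open>j\<close> is the outer index, which gives the order by \<open>j\<close> first
  and then by \<open>i\<close>.\<close>

definition fusion_product :: "nat \<Rightarrow> ratfun group_alg" where
  "fusion_product n = ga_prod_list n [fusion_factor i j. j \<leftarrow> [1..<n + 1], i \<leftarrow> [1..<j]]"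

definition matrix_element ::
    "nat \<Rightarrow> ((nat \<Rightarrow> nat) \<Rightarrow> 'v \<Rightarrow> 'v) \<Rightarrow> ('v \<Rightarrow> 'v \<Rightarrow> complex) \<Rightarrow> 'v \<Rightarrow> complex group_alg" where
  "matrix_element n act ip x =
     (\<lambda>t. \<Sum>s | s permutes {1..n}. ip (act s x) x * ga_basis (inv s) t)"

end

(*
  The value of the fusion product after k evaluations is M_k, the part supported on S_k of the
  diagonal matrix element of v = v_T, times the factors (i j) with j > k. Passing from M_(m-1) to M_m
  means evaluating F(u) = M_(m-1) (1 - (1 m)/(c_1 - u)) ... (1 - (m-1 m)/(c_(m-1) - u)) at u = c_m.
  Since M_(m-1) is an eigenvector of the Jucys--Murphy elements x_i = (1 i) + ... + (i-1 i), i < m,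
  one has (u - x_m) F(u) = u g(u) M_(m-1) with g(u) the product of the 1 - 1/(u - c_i)^2. Counting the
  cells on three neighbouring diagonals shows that u g(u) vanishes at c_m, and as x_m is self-adjoint
  for the standard inner product of the group algebra, F is regular at c_m and F(c_m) is an
  eigenvector of x_m for c_m. Moreover F(c_m) agrees with M_(m-1) on S_(m-1), and right
  multiplication by M_(m-1) multiplies it by the same nonzero scalar as M_m. These properties
  characterise M_m: the difference of two such elements produces a vector of V_lambda on which x_(m-1)
  and x_m have the same eigenvalue, and consecutive contents of a standard tableau are distinct.
*)

theory Submission
  imports Defs "HOL-Computational_Algebra.Polynomial"
begin

text \<open>The obstacle is that D(u), the product of the u - c_i with i < m, has a zero at c_m
  whose order r is the number of earlier entries on the diagonal of m. The numerator has to cancel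
  it, and the relation for (u - x_m) F(u) does not give this at once, as u - x_m is in general not
  invertible at c_m. With denominators cleared, the right side of the relation vanishes at c_m to
  order r + 1. Factors u - c_m are split off the numerator one at a time. As long as fewer than r
  are removed, the value at c_m of what is left lies in the kernel of c_m - x_m and, by the
  derivative of the relation, also in its image; for a self-adjoint operator these meet only in 0.
  After r removals the derivative carries an extra multiple of M_(m-1). Right multiplication by
  M_(m-1) commutes with left multiplication by x_m, so the same argument, applied to the failure of
  the value to be an eigenvector of that right multiplication, shows that there is no failure. The
  relation itself comes from the reversed product with opposite signs, whose factors pair off into
  (u - c_i)^2 - 1.\<close>

hide_const (open) Polynomial.content

section \<open>Products of Jucys--Murphy type factors\<close>

lemma transpose_conj:
  assumes "i \<noteq> k" "i \<noteq> m" "k \<noteq> m"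
  shows "transpose i m \<circ> transpose k m = transpose k m \<circ> transpose i k"
  using assms by (auto simp: fun_eq_iff transpose_def)

lemma transpose_comp_perm:
  assumes "inj f"
  shows "f \<circ> transpose i j = transpose (f i) (f j) \<circ> f"
  using assms by (auto simp: fun_eq_iff transpose_def inj_def)

text \<open>Functions on permutations stand for elements of the group algebra with coefficients in a
  commutative ring: \<open>B (t \<circ> transpose i m)\<close> is the coefficient of \<open>t\<close> in \<open>B (i m)\<close>, and
  \<open>B (transpose i m \<circ> t)\<close> the one in \<open>(i m) B\<close>. The products below are
  \<open>B ((u - a\<^sub>k) - (k m)) \<dots> ((u - a\<^sub>1) - (1 m))\<close> and
  \<open>B ((u - a\<^sub>1) + (1 m)) \<dots> ((u - a\<^sub>k) + (k m))\<close>.\<close>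

definition descending_factor where
  "descending_factor u a m i B = (\<lambda>t. (u - a i) * B t - B (t \<circ> transpose i m))"
  for u :: "'a::comm_ring_1" and a :: "nat \<Rightarrow> 'a" and B :: "(nat \<Rightarrow> nat) \<Rightarrow> 'a"

definition ascending_factor where
  "ascending_factor u a m i B = (\<lambda>t. (u - a i) * B t + B (t \<circ> transpose i m))"
  for u :: "'a::comm_ring_1" and a :: "nat \<Rightarrow> 'a" and B :: "(nat \<Rightarrow> nat) \<Rightarrow> 'a"

fun descending_prod where
  "descending_prod u a m 0 B = B"
| "descending_prod u a m (Suc k) B = descending_prod u a m k (descending_factor u a m (Suc k) B)"

fun ascending_prod where
  "ascending_prod u a m 0 B = B"
| "ascending_prod u a m (Suc k) B = ascending_factor u a m (Suc k) (ascending_prod u a m k B)"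

lemma descending_prod_diff:
  "descending_prod u a m k (\<lambda>t. r * B t - C t) = (\<lambda>t. r * descending_prod u a m k B t - descending_prod u a m k C t)"
proof (induction k arbitrary: B C)
  case (Suc k)
  have "descending_factor u a m (Suc k) (\<lambda>t. r * B t - C t) =
      (\<lambda>t. r * descending_factor u a m (Suc k) B t - descending_factor u a m (Suc k) C t)"
    by (simp add: descending_factor_def algebra_simps)
  then show ?case by (simp add: Suc)
qed simp

text \<open>Since (l m)(i m) = (i l)(l m), carrying (l m) to the right through the factors turns the
  product for \<open>m\<close> into the product for \<open>l\<close>. This is what lets the
  induction in \<open>descending_prod_eigen\<close> descend to a smaller group.\<close>

lemma descending_prod_translate:
  assumes "k < l" "l < m"
  shows "descending_prod u a m k (\<lambda>t. B (t \<circ> transpose l m)) =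
    (\<lambda>t. descending_prod u a l k B (t \<circ> transpose l m))"
  using assms
proof (induction k arbitrary: B)
  case (Suc k)
  have "t \<circ> transpose (Suc k) m \<circ> transpose l m = t \<circ> transpose l m \<circ> transpose (Suc k) l" for t :: "nat \<Rightarrow> nat"
    using Suc.prems transpose_conj[of "Suc k" l m] by (simp add: comp_assoc)
  then have "descending_factor u a m (Suc k) (\<lambda>t. B (t \<circ> transpose l m)) =
      (\<lambda>t. descending_factor u a l (Suc k) B (t \<circ> transpose l m))"
    by (simp add: descending_factor_def)
  then show ?case using Suc by (simp del: comp_apply)
qed simp

text \<open>The induction hypothesis is used twice: for \<open>m\<close>, and with
  \<open>Suc k\<close> in the place of \<open>m\<close>. In the second instance the sum of
  transpositions is the Jucys--Murphy element of \<open>Suc k\<close>, which acts on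
  \<open>A\<close> by \<open>a (Suc k)\<close>, so the missing factor \<open>u - a (Suc k)\<close>
  comes out.\<close>

lemma descending_prod_eigen:
  assumes "\<And>i t. i \<in> {1..k} \<Longrightarrow> (\<Sum>l\<in>{1..<i}. A (t \<circ> transpose l i)) = a i * A t" "k < m"
  shows "u * descending_prod u a m k A t =
    (\<Prod>i\<in>{1..k}. u - a i) * (u * A t - (\<Sum>i\<in>{1..k}. A (t \<circ> transpose i m)))"
  using assms
proof (induction k arbitrary: m t)
  case (Suc k)
  let ?P = "\<Prod>i\<in>{1..k}. u - a i"
  have s1: "{1..Suc k} = insert (Suc k) {1..k}" by auto
  have e: "(\<Sum>l\<in>{1..k}. A (s \<circ> transpose l (Suc k))) = a (Suc k) * A s" for s
    using Suc.prems(1)[of "Suc k" s] by (simp add: atLeastLessThanSuc_atLeastAtMost del: comp_apply)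
  have IH1: "u * descending_prod u a m k A t = ?P * (u * A t - (\<Sum>i\<in>{1..k}. A (t \<circ> transpose i m)))"
    using Suc.IH[of m t] Suc.prems by (auto simp del: comp_apply)
  have IH2: "u * descending_prod u a (Suc k) k A (t \<circ> transpose (Suc k) m) =
     ?P * (u * A (t \<circ> transpose (Suc k) m) - a (Suc k) * A (t \<circ> transpose (Suc k) m))"
    using Suc.IH[of "Suc k" "t \<circ> transpose (Suc k) m"] Suc.prems(1) e by (auto simp del: comp_apply)
  have "u * descending_prod u a m (Suc k) A t =
      (u - a (Suc k)) * (u * descending_prod u a m k A t)
       - u * descending_prod u a (Suc k) k A (t \<circ> transpose (Suc k) m)"
    using Suc.prems(2) descending_prod_translate[of k "Suc k" m u a A, THEN fun_cong, of t]
    by (simp add: descending_factor_def descending_prod_diff right_diff_distrib mult.left_commute)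
  also have "\<dots> = (\<Prod>i\<in>{1..Suc k}. u - a i) *
      (u * A t - (\<Sum>i\<in>{1..Suc k}. A (t \<circ> transpose i m)))"
    unfolding IH1 IH2 s1 by (simp add: algebra_simps)
  finally show ?case .
qed simp

lemma ascending_prod_diff:
  "ascending_prod u a m k (\<lambda>t. r * B t - C t) = (\<lambda>t. r * ascending_prod u a m k B t - ascending_prod u a m k C t)"
  by (induction k) (simp_all add: ascending_factor_def algebra_simps)

lemma ascending_prod_scale:
  "ascending_prod u a m k (\<lambda>t. r * B t) = (\<lambda>t. r * ascending_prod u a m k B t)"
  by (induction k) (simp_all add: ascending_factor_def algebra_simps)

lemma ascending_prod_sum:
  "ascending_prod u a m k (\<lambda>t. \<Sum>i\<in>I. B i t) = (\<lambda>t. \<Sum>i\<in>I. ascending_prod u a m k (B i) t)"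
  by (induction k) (simp_all add: ascending_factor_def sum_distrib_left sum.distrib)

lemma ascending_prod_left_translate:
  "ascending_prod u a m k (\<lambda>t. B (h \<circ> t)) = (\<lambda>t. ascending_prod u a m k B (h \<circ> t))"
  by (induction k) (simp_all add: ascending_factor_def comp_assoc del: comp_apply)

text \<open>The two products are mirror images of each other. At the place where they meet stand ((u
  - a_1) - (1 m)) and ((u - a_1) + (1 m)), whose product is the scalar (u - a_1)^2 - 1; then the
  factors for 2 meet, and so on outwards.\<close>

lemma ascending_descending_prod:
  "ascending_prod u a m k (descending_prod u a m k A) = (\<lambda>t. (\<Prod>i\<in>{1..k}. (u - a i)\<^sup>2 - 1) * A t)"
proof (induction k arbitrary: A)
  case (Suc k)
  have s1: "{1..Suc k} = insert (Suc k) {1..k}" by auto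
  show ?case
    unfolding ascending_prod.simps descending_prod.simps Suc.IH s1
    by (simp add: ascending_factor_def descending_factor_def fun_eq_iff comp_assoc algebra_simps power2_eq_square)
qed simp

text \<open>The ascending product is applied to the identity of
  \<open>descending_prod_eigen\<close>. Because of \<open>central\<close> the Jucys--Murphy element
  can be put to the left of \<open>A\<close>, where the right multiplications that make up the
  product do not touch it. Thus \<open>F\<close> is a resolvent of left multiplication by x_m,
  cleared of denominators.\<close>

lemma ascending_prod_resolvent:
  fixes u :: "'a::comm_ring_1"
  assumes eigen: "\<And>i t. i \<in> {1..<m} \<Longrightarrow> (\<Sum>l\<in>{1..<i}. A (t \<circ> transpose l i)) = a i * A t"
    and central: "\<And>t. (\<Sum>i\<in>{1..<m}. A (transpose i m \<circ> t)) = (\<Sum>i\<in>{1..<m}. A (t \<circ> transpose i m))"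
  defines "F \<equiv> ascending_prod u a m (m - 1) A"
  shows "(\<Prod>i\<in>{1..<m}. u - a i) * (u * F t - (\<Sum>i\<in>{1..<m}. F (transpose i m \<circ> t))) =
    u * (\<Prod>i\<in>{1..<m}. (u - a i)\<^sup>2 - 1) * A t"
proof (cases "m = 0")
  case False
  then have s: "{1..<m} = {1..m - 1}" by auto
  then have s': "{Suc 0..m - Suc 0} = {Suc 0..<m}" by simp
  let ?k = "m - 1" and ?D = "\<Prod>i\<in>{1..<m}. u - a i"
  have "(\<lambda>t. u * descending_prod u a m ?k A t) = (\<lambda>t. ?D * (u * A t - (\<Sum>i\<in>{1..<m}. A (transpose i m \<circ> t))))"
  proof
    fix t
    show "u * descending_prod u a m ?k A t = ?D * (u * A t - (\<Sum>i\<in>{1..<m}. A (transpose i m \<circ> t)))"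
      using central[of t] descending_prod_eigen[of "m - 1" A a m u t] eigen False unfolding s by simp
  qed
  then have "ascending_prod u a m ?k (\<lambda>t. u * descending_prod u a m ?k A t) t =
     ascending_prod u a m ?k (\<lambda>t. ?D * (u * A t - (\<Sum>i\<in>{1..<m}. A (transpose i m \<circ> t)))) t"
    by simp
  then show ?thesis
    unfolding F_def by (simp add: ascending_prod_scale ascending_prod_diff ascending_prod_sum
        ascending_prod_left_translate ascending_descending_prod mult.assoc s')
qed (simp add: F_def)

text \<open>Expand the product: a term using (i m) for the indices i_1 < i_2 < ... sends i_1 to
  \<open>m\<close>. Hence the preimage of \<open>m\<close> is at most \<open>k\<close> or equals
  \<open>m\<close>, and it equals \<open>m\<close> only for the term without transpositions. The
  first claim feeds the induction step of the second.\<close>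

lemma ascending_prod_support:
  assumes supp: "\<And>t. A t \<noteq> 0 \<Longrightarrow> t permutes {1..<m}" and "k < m"
  shows "k < j \<Longrightarrow> j < m \<Longrightarrow> t j = m \<Longrightarrow> ascending_prod u a m k A t = 0"
    and "t m = m \<Longrightarrow> ascending_prod u a m k A t = (\<Prod>i\<in>{1..k}. u - a i) * A t"
  using \<open>k < m\<close>
proof (induction k arbitrary: t j)
  case 0
  {
    case 1
    then have "\<not> t permutes {1..<m}"
      using permutes_in_image[of t "{1..<m}" j] by auto
    then show ?case using supp by auto
  next
    case 2
    then show ?case by simp
  }
next
  case (Suc k)
  have s1: "{1..Suc k} = insert (Suc k) {1..k}" by auto
  {
    case 1
    then have "(t \<circ> transpose (Suc k) m) j = m" by (simp add: transpose_def)
    then have "ascending_prod u a m k A (t \<circ> transpose (Suc k) m) = 0" "ascending_prod u a m k A t = 0"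
      using Suc.IH(1)[of j] 1 by auto
    then show ?case by (simp add: ascending_factor_def)
  next
    case 2
    have "(t \<circ> transpose (Suc k) m) (Suc k) = m" using 2 by simp
    then have "ascending_prod u a m k A (t \<circ> transpose (Suc k) m) = 0"
      using Suc.IH(1)[of "Suc k"] 2 by auto
    then show ?case
      unfolding s1 using Suc.IH(2)[of t] 2 by (simp add: ascending_factor_def algebra_simps)
  }
qed

lemma ascending_prod_zero_outside:
  assumes "\<And>t. A t \<noteq> 0 \<Longrightarrow> t permutes S" "{1..k} \<subseteq> S" "m \<in> S"
  shows "ascending_prod u a m k A t \<noteq> 0 \<Longrightarrow> t permutes S"
  using assms(2)
proof (induction k arbitrary: t)
  case (Suc k)
  let ?s = "transpose (Suc k) m"
  have sp: "?s permutes S" using Suc.prems assms(3) by (intro permutes_swap_id) auto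
  from Suc.prems have "ascending_prod u a m k A t \<noteq> 0 \<or> ascending_prod u a m k A (t \<circ> ?s) \<noteq> 0"
    by (auto simp: ascending_factor_def)
  then have "t permutes S \<or> (t \<circ> ?s) permutes S"
    using Suc.IH Suc.prems(2) by (meson atLeastatMost_subset_iff le_SucI order_refl subset_trans)
  moreover have "t = (t \<circ> ?s) \<circ> ?s" by (simp add: comp_assoc)
  ultimately show ?case using permutes_compose[OF sp] by metis
qed (use assms in simp)

text \<open>\<open>Z\<close> lies in the image and in the kernel of the operator c - x_m of left
  multiplication. Transpositions are involutions and \<open>c\<close> is real, so this operator is
  self-adjoint and \<open>Z\<close> is orthogonal to itself.\<close>

lemma left_regular_eigen_zero:
  fixes Y :: "(nat \<Rightarrow> nat) \<Rightarrow> complex" and c :: complex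
  assumes "m \<in> {1..n}" and c: "c \<in> \<real>"
    and Z: "\<And>g. g permutes {1..n} \<Longrightarrow> Z g = c * Y g - (\<Sum>i\<in>{1..<m}. Y (transpose i m \<circ> g))"
    and eigen: "\<And>g. g permutes {1..n} \<Longrightarrow> (\<Sum>i\<in>{1..<m}. Z (transpose i m \<circ> g)) = c * Z g"
    and g: "g permutes {1..n}"
  shows "Z g = 0"
proof -
  let ?P = "{g. g permutes {1..n}}"
  have fin: "finite ?P" by (simp add: finite_permutations)
  have tr: "transpose i m permutes {1..n}" if "i \<in> {1..<m}" for i
    using that assms(1) by (intro permutes_swap_id) auto
  have shift: "(\<Sum>g\<in>?P. Y (transpose i m \<circ> g) * cnj (Z g)) = (\<Sum>g\<in>?P. Y g * cnj (Z (transpose i m \<circ> g)))"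
    if "i \<in> {1..<m}" for i
    by (rule sum.reindex_bij_witness[where i = "\<lambda>g. transpose i m \<circ> g" and j = "\<lambda>g. transpose i m \<circ> g"])
      (use permutes_compose[OF _ tr[OF that]] in \<open>auto simp flip: comp_assoc\<close>)
  have "(\<Sum>g\<in>?P. Z g * cnj (Z g)) =
      (\<Sum>g\<in>?P. c * Y g * cnj (Z g)) - (\<Sum>i\<in>{1..<m}. \<Sum>g\<in>?P. Y (transpose i m \<circ> g) * cnj (Z g))"
  proof -
    have "(\<Sum>g\<in>?P. Z g * cnj (Z g)) =
        (\<Sum>g\<in>?P. (c * Y g - (\<Sum>i\<in>{1..<m}. Y (transpose i m \<circ> g))) * cnj (Z g))"
      by (rule sum.cong) (use Z in auto)
    also have "\<dots> = (\<Sum>g\<in>?P. c * Y g * cnj (Z g)) -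
        (\<Sum>g\<in>?P. \<Sum>i\<in>{1..<m}. Y (transpose i m \<circ> g) * cnj (Z g))"
      by (simp add: left_diff_distrib sum_subtractf sum_distrib_right)
    finally show ?thesis by (subst sum.swap)
  qed
  also have "\<dots> = (\<Sum>g\<in>?P. Y g * cnj (c * Z g - (\<Sum>i\<in>{1..<m}. Z (transpose i m \<circ> g))))"
  proof -
    have cc: "cnj c = c" using c Reals_cnj_iff by blast
    have "(\<Sum>g\<in>?P. Y g * cnj (c * Z g - (\<Sum>i\<in>{1..<m}. Z (transpose i m \<circ> g)))) =
      (\<Sum>g\<in>?P. c * Y g * cnj (Z g)) - (\<Sum>g\<in>?P. \<Sum>i\<in>{1..<m}. Y g * cnj (Z (transpose i m \<circ> g)))"
      by (simp add: cc algebra_simps sum_subtractf sum_distrib_left cnj_sum)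
    also have "(\<Sum>g\<in>?P. \<Sum>i\<in>{1..<m}. Y g * cnj (Z (transpose i m \<circ> g))) =
       (\<Sum>i\<in>{1..<m}. \<Sum>g\<in>?P. Y (transpose i m \<circ> g) * cnj (Z g))"
      by (subst sum.swap) (rule sum.cong[OF refl], simp only: shift)
    finally show ?thesis by (simp del: comp_apply)
  qed
  also have "\<dots> = 0"
    by (intro sum.neutral) (auto simp: eigen[unfolded One_nat_def] simp del: complex_cnj_diff cnj_sum)
  finally have "(\<Sum>g\<in>?P. complex_of_real ((norm (Z g))\<^sup>2)) = 0"
    by (simp only: complex_norm_square)
  then have "(\<Sum>g\<in>?P. (norm (Z g))\<^sup>2) = 0"
    by (metis of_real_eq_0_iff of_real_sum)
  then show ?thesis using fin g by (simp add: sum_nonneg_eq_0_iff)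
qed

text \<open>From w (j m) = (w(j) m) w it follows that x_m commutes with everything supported on
  S_(m-1). On coefficients, a nonzero term i on the left is matched with the term j on the right for
  which (i m) t = t (j m) = w, and then i = w(j).\<close>

lemma sum_transpose_commute:
  fixes f :: "(nat \<Rightarrow> nat) \<Rightarrow> 'a::comm_ring_1"
  assumes supp: "\<And>t. f t \<noteq> 0 \<Longrightarrow> t permutes {1..<m}"
  shows "(\<Sum>i\<in>{1..<m}. f (transpose i m \<circ> t)) = (\<Sum>i\<in>{1..<m}. f (t \<circ> transpose i m))"
proof -
  let ?I = "{i \<in> {1..<m}. (transpose i m \<circ> t) permutes {1..<m}}"
  let ?J = "{i \<in> {1..<m}. (t \<circ> transpose i m) permutes {1..<m}}"
  have conj: "w \<circ> transpose j m = transpose (w j) m \<circ> w" if "w permutes {1..<m}" for w j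
    using transpose_comp_perm[OF permutes_inj[OF that]] permutes_not_in[OF that, of m] by auto
  have "(\<Sum>i\<in>{1..<m}. f (transpose i m \<circ> t)) = (\<Sum>i\<in>?I. f (transpose i m \<circ> t))"
    by (rule sum.mono_neutral_right) (use supp in auto)
  also have "\<dots> = (\<Sum>i\<in>?J. f (t \<circ> transpose i m))"
  proof (rule sum.reindex_bij_witness[where i = "\<lambda>j. (t \<circ> transpose j m) j"
        and j = "\<lambda>i. inv (transpose i m \<circ> t) i"])
    fix i assume "i \<in> ?I"
    then have i: "i \<in> {1..<m}" and w: "(transpose i m \<circ> t) permutes {1..<m}" by auto
    define w where "w = transpose i m \<circ> t"
    define j where "j = inv w i"
    have w': "w permutes {1..<m}" and wj: "w j = i"
      using w permutes_inverses(1)[of w "{1..<m}"] by (auto simp: w_def[symmetric] j_def)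
    have j: "j \<in> {1..<m}"
      using permutes_in_image[OF permutes_inv[OF w'], of i] i by (simp add: j_def)
    have "t = transpose i m \<circ> w" by (simp add: w_def flip: comp_assoc)
    then have t: "t = w \<circ> transpose j m" using conj[OF w', of j] wj by simp
    then have e: "t \<circ> transpose j m = w" by (simp add: comp_assoc)
    show "(t \<circ> transpose (inv (transpose i m \<circ> t) i) m) (inv (transpose i m \<circ> t) i) = i"
      using e wj unfolding w_def[symmetric] j_def[symmetric] by simp
    show "inv (transpose i m \<circ> t) i \<in> ?J"
      using e j w' unfolding w_def[symmetric] j_def[symmetric] by simp
    show "f (t \<circ> transpose (inv (transpose i m \<circ> t) i) m) = f (transpose i m \<circ> t)"
      using e unfolding w_def[symmetric] j_def[symmetric] by simp
  next
    fix j assume "j \<in> ?J"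
    then have j: "j \<in> {1..<m}" and w: "(t \<circ> transpose j m) permutes {1..<m}" by auto
    define w where "w = t \<circ> transpose j m"
    have w': "w permutes {1..<m}" using w by (simp add: w_def)
    have "t = w \<circ> transpose j m" by (simp add: w_def comp_assoc)
    then have "t = transpose (w j) m \<circ> w" using conj[OF w', of j] by simp
    then have e: "transpose (w j) m \<circ> t = w" by (simp flip: comp_assoc)
    have "w j \<in> {1..<m}" using permutes_in_image[OF w', of j] j by simp
    then show "(t \<circ> transpose j m) j \<in> ?I" using e w' unfolding w_def[symmetric] by simp
    show "inv (transpose ((t \<circ> transpose j m) j) m \<circ> t) ((t \<circ> transpose j m) j) = j"
      using e w' unfolding w_def[symmetric] by (simp add: permutes_inverses)
  qed
  also have "\<dots> = (\<Sum>i\<in>{1..<m}. f (t \<circ> transpose i m))"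
    by (rule sum.mono_neutral_left) (use supp in auto)
  finally show ?thesis .
qed

section \<open>Contents of standard tableaux\<close>

lemma diagram_down_closed:
  assumes "sorted_wrt (\<ge>) lam" "(i, j) \<in> diagram lam" "1 \<le> i'" "i' \<le> i" "1 \<le> j'" "j' \<le> j"
  shows "(i', j') \<in> diagram lam"
proof -
  have "lam ! (i - 1) \<le> lam ! (i' - 1)" if "i' < i"
    using assms that sorted_wrt_nth_less[OF assms(1), of "i' - 1" "i - 1"] by (auto simp: diagram_def)
  then have "lam ! (i - 1) \<le> lam ! (i' - 1)"
    using assms(4) by (cases "i' = i") auto
  then show ?thesis using assms by (auto simp: diagram_def)
qed

locale std_tab =
  fixes lam :: "nat list" and T :: "nat \<times> nat \<Rightarrow> nat" and n :: nat
  assumes part: "partition_of n lam" and std: "standard_tableau lam T"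
begin

abbreviation "cell \<equiv> the_inv_into (diagram lam) T"

lemma T_bij: "bij_betw T (diagram lam) {1..n}"
  using part std by (simp add: partition_of_def standard_tableau_def tableau_def)

lemma cell: "k \<in> {1..n} \<Longrightarrow> cell k \<in> diagram lam" "k \<in> {1..n} \<Longrightarrow> T (cell k) = k"
  using T_bij the_inv_into_into[of T "diagram lam" k "diagram lam"] f_the_inv_into_f[of T "diagram lam" k]
  by (auto simp: bij_betw_def)

lemma cell_T: "x \<in> diagram lam \<Longrightarrow> cell (T x) = x" "x \<in> diagram lam \<Longrightarrow> T x \<in> {1..n}"
  using T_bij the_inv_into_f_f[of T "diagram lam" x] by (auto simp: bij_betw_def)

lemma content_T: "x \<in> diagram lam \<Longrightarrow> content lam T (T x) = cell_content x"
  by (simp add: Defs.content_def cell_T)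

lemma diagram_down: "(i, j) \<in> diagram lam \<Longrightarrow> 1 \<le> i' \<Longrightarrow> i' \<le> i \<Longrightarrow> 1 \<le> j' \<Longrightarrow> j' \<le> j \<Longrightarrow> (i', j') \<in> diagram lam"
  using diagram_down_closed part unfolding partition_of_def by blast

lemma diagram_pos: "(i, j) \<in> diagram lam \<Longrightarrow> 1 \<le> i" "(i, j) \<in> diagram lam \<Longrightarrow> 1 \<le> j"
  by (auto simp: diagram_def)

lemma T_less:
  assumes "(i, j) \<in> diagram lam" "(i', j') \<in> diagram lam" "i' \<le> i" "j' \<le> j" "(i', j') \<noteq> (i, j)"
  shows "T (i', j') < T (i, j)"
proof -
  have d: "(i, j') \<in> diagram lam" using diagram_down[of i j i j'] assms diagram_pos[of i j] diagram_pos[of i' j'] by auto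
  have "T (i', j') \<le> T (i, j')"
    using std d assms by (cases "i' = i") (auto simp: standard_tableau_def intro: less_imp_le)
  moreover have "T (i, j') \<le> T (i, j)"
    using std d assms by (cases "j' = j") (auto simp: standard_tableau_def intro: less_imp_le)
  moreover have "T (i', j') \<noteq> T (i, j)"
    using assms T_bij by (auto simp: bij_betw_def inj_on_def)
  ultimately show ?thesis by linarith
qed

lemma same_diagonal:
  assumes "x \<in> diagram lam" "y \<in> diagram lam" "cell_content x = cell_content y" "T x < T y"
  obtains d where "d \<ge> 1" "y = (fst x + d, snd x + d)"
proof -
  obtain i j i' j' where xy: "x = (i, j)" "y = (i', j')" by (metis surj_pair)
  have c: "int j - int i = int j' - int i'" using assms(3) xy by (simp add: cell_content_def)
  have "\<not> i' \<le> i"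
  proof
    assume "i' \<le> i"
    moreover have "j' \<le> j" using calculation c by linarith
    ultimately have "T y \<le> T x" using T_less[of i j i' j'] assms(1,2) xy by (cases "x = y") auto
    then show False using assms(4) by simp
  qed
  then show thesis using that[of "i' - i"] c xy by auto
qed

text \<open>If \<open>k\<close> and \<open>k + 1\<close> lay on one diagonal, the cell to the right
  of \<open>k\<close> would belong to the diagram and hold an entry strictly between them.\<close>

lemma content_Suc_neq:
  assumes "1 \<le> k" "k + 1 \<le> n"
  shows "content lam T (k + 1) \<noteq> content lam T k"
proof
  assume eq: "content lam T (k + 1) = content lam T k"
  have k: "k \<in> {1..n}" "k + 1 \<in> {1..n}" using assms by auto
  obtain i j where ij: "cell k = (i, j)" by force
  have "cell_content (cell k) = cell_content (cell (k + 1))" "T (cell k) < T (cell (k + 1))"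
    using eq cell(2)[OF k(1)] cell(2)[OF k(2)] by (simp_all add: Defs.content_def)
  then obtain d where d: "d \<ge> 1" "cell (k + 1) = (i + d, j + d)"
    using same_diagonal[OF cell(1)[OF k(1)] cell(1)[OF k(2)]] ij by auto
  have m: "(i, j) \<in> diagram lam" "(i + d, j + d) \<in> diagram lam" using cell(1) k ij d by metis+
  then have m': "(i, j + 1) \<in> diagram lam" using diagram_down[of "i + d" "j + d" i "j + 1"] d diagram_pos by auto
  have "T (i, j) < T (i, j + 1)" using T_less m m' by simp
  moreover have "T (i, j + 1) < T (i + d, j + d)" using T_less m m' d by simp
  ultimately show False using cell(2)[OF k(1)] cell(2)[OF k(2)] ij d by simp
qed

lemma content_one: assumes "1 \<le> n" shows "content lam T 1 = 0"
proof -
  have c: "cell 1 \<in> diagram lam" "T (cell 1) = 1" using cell[of 1] assms by auto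
  obtain i j where ij: "cell 1 = (i, j)" by force
  have m: "(i, j) \<in> diagram lam" "(1, 1) \<in> diagram lam" using c ij diagram_down[of i j 1 1] diagram_pos[of i j] by auto
  have "(1, 1) = (i, j)"
  proof (rule ccontr)
    assume "(1, 1) \<noteq> (i, j)"
    then have "T (1, 1) < T (i, j)" using T_less m diagram_pos[of i j] by blast
    then show False using cell_T(2)[OF m(2)] c ij by simp
  qed
  then show ?thesis unfolding Defs.content_def ij by (auto simp: cell_content_def)
qed

text \<open>With the corner of \<open>m\<close> at \<open>(i, j)\<close> of content \<open>c\<close>, the smaller cells of content \<open>c\<close>,
  \<open>c + 1\<close>, \<open>c - 1\<close> are the \<open>(i - t, j - t)\<close>, \<open>(i - t, j + 1 - t)\<close>, \<open>(i + 1 - t, j - t)\<close>.\<close>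

lemma content_multiplicity:
  assumes m: "m \<in> {1..n}" and c: "c = content lam T m"
  defines "N \<equiv> \<lambda>a. card {k \<in> {1..<m}. content lam T k = a}"
  shows "2 * N c + 1 \<le> N (c - 1) + N (c + 1) + (if c = 0 then 1 else 0)"
proof -
  define X where "X a = {x \<in> diagram lam. T x < m \<and> cell_content x = a}" for a
  have bij_X: "bij_betw T (X a) {k \<in> {1..<m}. content lam T k = a}" for a
  proof (rule bij_betwI[where g = cell])
    show "cell \<in> {k \<in> {1..<m}. content lam T k = a} \<rightarrow> X a"
      using cell m by (auto simp: X_def Defs.content_def)
    show "T \<in> X a \<rightarrow> {k \<in> {1..<m}. content lam T k = a}"
      using cell_T(2) content_T by (auto simp: X_def)
    show "\<And>x. x \<in> X a \<Longrightarrow> cell (T x) = x" using cell_T by (auto simp: X_def)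
    show "\<And>y. y \<in> {k \<in> {1..<m}. content lam T k = a} \<Longrightarrow> T (cell y) = y" using cell m by auto
  qed
  have N: "N a = card (X a)" for a
    using bij_betw_same_card[OF bij_X[of a]] by (simp add: N_def)
  have finX: "finite (X a)" for a
    using bij_betw_finite[OF bij_X[of a]] by simp
  obtain i j where ij: "cell m = (i, j)" by force
  have d: "(i, j) \<in> diagram lam" and Tm: "T (i, j) = m" using cell[OF m] ij by auto
  have p: "i \<ge> 1" "j \<ge> 1" using diagram_pos d by auto
  have cij: "c = int j - int i" using c ij by (simp add: Defs.content_def cell_content_def)
  have "X c \<subseteq> (\<lambda>t. (i - t, j - t)) ` {1..<min i j}"
  proof
    fix x assume x: "x \<in> X c"
    then obtain t where "t \<ge> 1" "(i, j) = (fst x + t, snd x + t)"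
      using same_diagonal[of x "(i, j)"] d Tm cij by (auto simp: X_def cell_content_def)
    moreover have "fst x \<ge> 1" "snd x \<ge> 1" using x diagram_pos by (auto simp: X_def diagram_def)
    ultimately show "x \<in> (\<lambda>t. (i - t, j - t)) ` {1..<min i j}"
      by (intro image_eqI[of _ _ t]) (auto simp: prod_eq_iff)
  qed
  then have "card (X c) \<le> card ((\<lambda>t. (i - t, j - t)) ` {1..<min i j})"
    by (intro card_mono) auto
  also have "\<dots> \<le> min i j - 1" using card_image_le[of "{1..<min i j}"] by simp
  finally have N0: "N c \<le> min i j - 1" by (simp add: N)
  have "(\<lambda>t. (i - t, j + 1 - t)) ` {1..min (i - 1) j} \<subseteq> X (c + 1)"
  proof
    fix x assume "x \<in> (\<lambda>t. (i - t, j + 1 - t)) ` {1..min (i - 1) j}"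
    then obtain t where t: "t \<ge> 1" "t \<le> i - 1" "t \<le> j" "x = (i - t, j + 1 - t)" by auto
    then have x: "x \<in> diagram lam" using diagram_down[OF d, of "i - t" "j + 1 - t"] by auto
    then have "T x < m" using T_less[OF d, of "i - t" "j + 1 - t"] t Tm by auto
    then show "x \<in> X (c + 1)" using x t cij by (auto simp: X_def cell_content_def of_nat_diff)
  qed
  then have "card ((\<lambda>t. (i - t, j + 1 - t)) ` {1..min (i - 1) j}) \<le> N (c + 1)"
    unfolding N using finX by (intro card_mono)
  moreover have "card ((\<lambda>t. (i - t, j + 1 - t)) ` {1..min (i - 1) j}) = min (i - 1) j"
    by (subst card_image) (auto simp: inj_on_def)
  ultimately have N1: "min (i - 1) j \<le> N (c + 1)" by simp
  have "(\<lambda>t. (i + 1 - t, j - t)) ` {1..min i (j - 1)} \<subseteq> X (c - 1)"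
  proof
    fix x assume "x \<in> (\<lambda>t. (i + 1 - t, j - t)) ` {1..min i (j - 1)}"
    then obtain t where t: "t \<ge> 1" "t \<le> i" "t \<le> j - 1" "x = (i + 1 - t, j - t)" by auto
    have x: "x \<in> diagram lam" using t diagram_down[OF d, of "i + 1 - t" "j - t"] by auto
    moreover have "i + 1 - t \<le> i" "j - t \<noteq> j" using t by auto
    ultimately have "T x < m" using T_less[OF d, of "i + 1 - t" "j - t"] t Tm by auto
    then show "x \<in> X (c - 1)" using x t cij by (auto simp: X_def cell_content_def of_nat_diff)
  qed
  then have "card ((\<lambda>t. (i + 1 - t, j - t)) ` {1..min i (j - 1)}) \<le> N (c - 1)"
    unfolding N using finX by (intro card_mono)
  moreover have "card ((\<lambda>t. (i + 1 - t, j - t)) ` {1..min i (j - 1)}) = min i (j - 1)"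
    by (subst card_image) (auto simp: inj_on_def)
  ultimately have N2: "min i (j - 1) \<le> N (c - 1)" by simp
  \<comment> \<open>Off the main diagonal, one of the two neighbouring diagonals contributes a cell
    more than the other. On it both contribute i - 1 cells, and the missing unit is the extra 1 for
    c = 0, which later comes from the factor u.\<close>
  consider "i < j" | "i = j" | "j < i" by linarith
  then show ?thesis
    using N0 N1 N2 cij p by cases (simp_all add: min_absorb1 min_absorb2)
qed

end

text \<open>By induction the cells of all smaller entries agree, and the content fixes the diagonal
  of \<open>k\<close>. On that diagonal \<open>k\<close> must take the first cell left free, so its
  position is forced too.\<close>

lemma std_tab_eqI:
  assumes "std_tab lam T n" "std_tab lam T' n"
    and contents: "\<And>k. k \<in> {1..n} \<Longrightarrow> content lam T k = content lam T' k"
  shows "T = T'"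
proof -
  interpret t: std_tab lam T n by fact
  interpret t': std_tab lam T' n by fact
  have "t.cell k = t'.cell k" if "k \<in> {1..n}" for k
    using that
  proof (induction k rule: less_induct)
    case (less k)
    \<comment> \<open>Stated for arbitrary \<open>S\<close> and \<open>S'\<close>, so that it serves
      both orders of the two tableaux. The cell of \<open>k\<close> in \<open>S\<close> holds in
      \<open>S'\<close> an entry smaller than \<open>k\<close>, and by hypothesis that entry
      occupies the same cell in \<open>S\<close>.\<close>
    have before: False
      if s: "std_tab lam S n" "std_tab lam S' n" and k: "k \<in> {1..n}"
        and c: "content lam S k = content lam S' k"
        and IH: "\<And>l. l < k \<Longrightarrow> l \<in> {1..n} \<Longrightarrow>
          the_inv_into (diagram lam) S l = the_inv_into (diagram lam) S' l"
        and lt: "fst (the_inv_into (diagram lam) S k) < fst (the_inv_into (diagram lam) S' k)"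
      for S S'
    proof -
      interpret s: std_tab lam S n by fact
      interpret s': std_tab lam S' n by fact
      obtain i j i' j' where e: "s.cell k = (i, j)" "s'.cell k = (i', j')" by force
      have d: "(i, j) \<in> diagram lam" "(i', j') \<in> diagram lam" using s.cell(1) s'.cell(1) k e by metis+
      have "i < i'" "j < j'" using lt c e by (auto simp: Defs.content_def cell_content_def)
      then have "S' (i, j) < k" using s'.T_less[OF d(2,1)] s'.cell(2)[OF k] e by simp
      then have "s.cell (S' (i, j)) = (i, j)"
        using IH[of "S' (i, j)"] s'.cell_T[OF d(1)] by simp
      then have "S' (i, j) = k" using s.cell(2)[of "S' (i, j)"] s'.cell_T(2)[OF d(1)] s.cell(2)[OF k] e by simp
      then show False using \<open>S' (i, j) < k\<close> by simp
    qed
    have c: "content lam T k = content lam T' k" using contents less.prems by blast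
    have "fst (t.cell k) = fst (t'.cell k)"
    proof (rule ccontr)
      assume "fst (t.cell k) \<noteq> fst (t'.cell k)"
      then consider "fst (t.cell k) < fst (t'.cell k)" | "fst (t'.cell k) < fst (t.cell k)" by linarith
      then show False
      proof cases
        case 1
        show False by (rule before[OF assms(1,2) less.prems c less.IH 1])
      next
        case 2
        show False by (rule before[OF assms(2,1) less.prems c[symmetric] less.IH[symmetric] 2])
      qed
    qed
    then show ?case using c by (auto simp: Defs.content_def cell_content_def prod_eq_iff)
  qed
  then have "T x = T' x" if "x \<in> diagram lam" for x
    using t.cell_T[OF that] t'.cell(2)[of "T x"] by metis
  moreover have "T x = T' x" if "x \<notin> diagram lam" for x
    using that t.std t'.std unfolding standard_tableau_def tableau_def by metis
  ultimately show ?thesis by blast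
qed

section \<open>Exchange of two consecutive entries\<close>

context std_tab
begin

lemma swap_tableau:
  assumes "1 \<le> k" "k + 1 \<le> n"
  shows "tableau lam (swap_entries k T)"
proof -
  have "transpose k (k + 1) permutes {1..n}" using assms by (intro permutes_swap_id) auto
  then have "bij_betw (transpose k (k + 1)) {1..n} {1..n}" by (rule permutes_imp_bij)
  then have "bij_betw (swap_entries k T) (diagram lam) {1..sum_list lam}"
    using bij_betw_trans[OF T_bij] part unfolding swap_entries_def partition_of_def by blast
  then show ?thesis
    using std assms
    by (auto simp: standard_tableau_def tableau_def swap_entries_def transpose_def)
qed

lemma content_swap:
  assumes "1 \<le> k" "k + 1 \<le> n" "l \<in> {1..n}"
  shows "content lam (swap_entries k T) l = content lam T (transpose k (k + 1) l)"
proof -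
  let ?s = "transpose k (k + 1)"
  have inj: "inj_on (swap_entries k T) (diagram lam)"
    using swap_tableau[OF assms(1,2)] by (simp add: tableau_def bij_betw_def)
  have "?s l \<in> {1..n}" using assms by (auto simp: transpose_def)
  then have "cell (?s l) \<in> diagram lam" "swap_entries k T (cell (?s l)) = l"
    using cell by (auto simp: swap_entries_def)
  then have "the_inv_into (diagram lam) (swap_entries k T) l = cell (?s l)"
    using the_inv_into_f_eq[OF inj] by blast
  then show ?thesis by (simp add: Defs.content_def)
qed

text \<open>The exchange reverses only the order of \<open>k\<close> and \<open>k + 1\<close>, so it
  can break standardness only if they share a row or a column. A cell between them would hold an
  entry between them, so they are neighbours. This is the case in which the square root in Young's
  formula vanishes.\<close>

lemma swap_not_standard:
  assumes k: "1 \<le> k" "k + 1 \<le> n" and not_std: "\<not> standard_tableau lam (swap_entries k T)"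
  shows "\<bar>content lam T (k + 1) - content lam T k\<bar> = 1"
proof -
  have order: "a = k \<and> b = k + 1" if "a < b" "\<not> transpose k (k + 1) a < transpose k (k + 1) b" for a b
    using that by (auto simp: transpose_def split: if_splits)
  from not_std swap_tableau[OF k] consider
    (row) i j j' where "(i, j) \<in> diagram lam" "(i, j') \<in> diagram lam" "j < j'"
      "\<not> swap_entries k T (i, j) < swap_entries k T (i, j')"
    | (col) i i' j where "(i, j) \<in> diagram lam" "(i', j) \<in> diagram lam" "i < i'"
      "\<not> swap_entries k T (i, j) < swap_entries k T (i', j)"
    unfolding standard_tableau_def by blast
  then show ?thesis
  proof cases
    case row
    have e: "T (i, j) = k" "T (i, j') = k + 1"
      using order[of "T (i, j)" "T (i, j')"] row T_less[of i j' i j] by (auto simp: swap_entries_def)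
    have m: "(i, j + 1) \<in> diagram lam" using diagram_down[OF row(2), of i "j + 1"] row diagram_pos by auto
    have "j' = j + 1"
    proof (rule ccontr)
      assume "j' \<noteq> j + 1"
      then have "T (i, j) < T (i, j + 1)" "T (i, j + 1) < T (i, j')" using T_less row m by auto
      then show False using e by simp
    qed
    then show ?thesis using content_T[OF row(1)] content_T[OF row(2)] e by (simp add: cell_content_def)
  next
    case col
    have e: "T (i, j) = k" "T (i', j) = k + 1"
      using order[of "T (i, j)" "T (i', j)"] col T_less[of i' j i j] by (auto simp: swap_entries_def)
    have m: "(i + 1, j) \<in> diagram lam" using diagram_down[OF col(2), of "i + 1" j] col diagram_pos by auto
    have "i' = i + 1"
    proof (rule ccontr)
      assume "i' \<noteq> i + 1"
      then have "T (i, j) < T (i + 1, j)" "T (i + 1, j) < T (i', j)" using T_less col m by auto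
      then show False using e by simp
    qed
    then show ?thesis using content_T[OF col(1)] content_T[OF col(2)] e by (simp add: cell_content_def)
  qed
qed

end

section \<open>Jucys--Murphy elements in the Young basis\<close>

context unitary_sym_rep
begin

lemma V_add: "x \<in> V \<Longrightarrow> y \<in> V \<Longrightarrow> x + y \<in> V"
  using subspace_V by (simp add: subspace_add)

lemma V_scale: "x \<in> V \<Longrightarrow> scale a x \<in> V"
  using subspace_V by (simp add: subspace_scale)

lemma V_zero: "0 \<in> V"
  using subspace_V by (simp add: subspace_0)

lemma V_sum: "(\<And>i. i \<in> I \<Longrightarrow> f i \<in> V) \<Longrightarrow> sum f I \<in> V"
  using subspace_V by (simp add: subspace_sum)

lemma ip_zero_left: "y \<in> V \<Longrightarrow> ip 0 y = 0"
  using ip_scale[of 0 y 0] V_zero by simp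

lemma ip_sum_left:
  "y \<in> V \<Longrightarrow> (\<And>i. i \<in> I \<Longrightarrow> f i \<in> V) \<Longrightarrow> ip (sum f I) y = (\<Sum>i\<in>I. ip (f i) y)"
  by (induction I rule: infinite_finite_induct) (auto simp: ip_zero_left ip_add V_sum)

lemma ip_add_right: "x \<in> V \<Longrightarrow> y \<in> V \<Longrightarrow> z \<in> V \<Longrightarrow> ip x (y + z) = ip x y + ip x z"
  using ip_cnj[of "y + z" x] ip_cnj[of y x] ip_cnj[of z x] by (simp add: ip_add V_add)

lemma ip_scale_right: "x \<in> V \<Longrightarrow> y \<in> V \<Longrightarrow> ip x (scale a y) = cnj a * ip x y"
  using ip_cnj[of "scale a y" x] ip_cnj[of y x] by (simp add: ip_scale V_scale)

lemma ip_zero_right: "x \<in> V \<Longrightarrow> ip x 0 = 0"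
  using ip_scale_right[of x 0 0] V_zero by simp

lemma ip_sum_right:
  "x \<in> V \<Longrightarrow> (\<And>i. i \<in> I \<Longrightarrow> f i \<in> V) \<Longrightarrow> ip x (sum f I) = (\<Sum>i\<in>I. ip x (f i))"
  by (induction I rule: infinite_finite_induct) (auto simp: ip_zero_right ip_add_right V_sum)

lemma act_zero: "s permutes {1..n} \<Longrightarrow> act s 0 = 0"
  using act_scale[of s 0 0] V_zero by simp

lemma act_sum:
  "s permutes {1..n} \<Longrightarrow> (\<And>i. i \<in> I \<Longrightarrow> f i \<in> V) \<Longrightarrow> act s (sum f I) = (\<Sum>i\<in>I. act s (f i))"
  by (induction I rule: infinite_finite_induct) (auto simp: act_zero act_add V_sum)

lemma act_adjoint:
  assumes "s permutes {1..n}" "x \<in> V" "y \<in> V"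
  shows "ip (act s x) y = ip x (act (inv s) y)"
proof -
  have i: "inv s permutes {1..n}" using assms(1) by (rule permutes_inv)
  have "act s (act (inv s) y) = y"
    using act_comp[OF assms(1) i assms(3)] act_id[OF assms(3)] by (simp add: permutes_inv_o[OF assms(1)])
  then show ?thesis using ip_invariant[OF assms(1,2) act_in[OF i assms(3)]] by simp
qed

definition jucys_murphy :: "nat \<Rightarrow> 'v \<Rightarrow> 'v" where
  "jucys_murphy k y = (\<Sum>i\<in>{1..<k}. act (transpose i k) y)"

lemma transpose_permutes: "k \<le> n \<Longrightarrow> i \<in> {1..<k} \<Longrightarrow> transpose i k permutes {1..n}"
  by (rule permutes_swap_id) auto

lemma jucys_murphy_add:
  "k \<le> n \<Longrightarrow> x \<in> V \<Longrightarrow> y \<in> V \<Longrightarrow> jucys_murphy k (x + y) = jucys_murphy k x + jucys_murphy k y"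
  unfolding jucys_murphy_def sum.distrib[symmetric]
  by (rule sum.cong) (use transpose_permutes act_add in auto)

lemma jucys_murphy_scale:
  "k \<le> n \<Longrightarrow> x \<in> V \<Longrightarrow> jucys_murphy k (scale a x) = scale a (jucys_murphy k x)"
  unfolding jucys_murphy_def scale_sum_right
  by (rule sum.cong) (use transpose_permutes act_scale in auto)

lemma jucys_murphy_self_adjoint:
  assumes "k \<le> n" "x \<in> V" "y \<in> V"
  shows "ip (jucys_murphy k x) y = ip x (jucys_murphy k y)"
proof -
  have t: "transpose i k permutes {1..n}" if "i \<in> {1..<k}" for i
    using transpose_permutes assms that by blast
  show ?thesis
    unfolding jucys_murphy_def
    using assms t act_in by (subst ip_sum_left ip_sum_right; simp add: act_adjoint)+
qed

text \<open>Conjugation by s = (k k+1) carries each (i k) to (i k+1), and the separate summand is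
  the remaining transposition s itself.\<close>

lemma jucys_murphy_Suc:
  assumes "1 \<le> k" "k + 1 \<le> n" "y \<in> V"
  shows "jucys_murphy (k + 1) y =
    act (transpose k (k + 1)) (jucys_murphy k (act (transpose k (k + 1)) y))
      + act (transpose k (k + 1)) y"
proof -
  let ?s = "transpose k (k + 1)"
  have s: "?s permutes {1..n}" using transpose_permutes[of "k + 1" k] assms by auto
  have t: "transpose i k permutes {1..n}" if "i \<in> {1..<k}" for i
    using transpose_permutes[of k i] that assms by auto
  have e: "transpose i (k + 1) = ?s \<circ> (transpose i k \<circ> ?s)" if "i \<in> {1..<k}" for i
    using that by (auto simp: fun_eq_iff transpose_def)
  have "act ?s (jucys_murphy k (act ?s y)) = (\<Sum>i\<in>{1..<k}. act ?s (act (transpose i k) (act ?s y)))"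
    unfolding jucys_murphy_def using s t assms act_in by (intro act_sum) auto
  also have "\<dots> = (\<Sum>i\<in>{1..<k}. act (transpose i (k + 1)) y)"
  proof (rule sum.cong[OF refl])
    fix i assume i: "i \<in> {1..<k}"
    show "act ?s (act (transpose i k) (act ?s y)) = act (transpose i (k + 1)) y"
      unfolding e[OF i] using act_comp[OF s permutes_compose[OF s t[OF i]] assms(3)]
        act_comp[OF t[OF i] s assms(3)] by simp
  qed
  finally show ?thesis
    using assms by (simp add: jucys_murphy_def)
qed

lemma jucys_murphy_commute:
  assumes "k \<le> n" "w permutes {1..<k}" "y \<in> V"
  shows "jucys_murphy k (act w y) = act w (jucys_murphy k y)"
proof -
  have w: "w permutes {1..n}" by (rule permutes_subset[OF assms(2)]) (use assms(1) in auto)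
  have t: "transpose i k permutes {1..n}" if "i \<in> {1..<k}" for i
    using transpose_permutes assms that by blast
  have "w k = k" using permutes_not_in[OF assms(2)] by simp
  then have e: "w \<circ> transpose i k = transpose (w i) k \<circ> w" for i
    using transpose_comp_perm[OF permutes_inj[OF w], of i k] by simp
  have bw: "bij_betw w {1..<k} {1..<k}" using assms(2) by (rule permutes_imp_bij)
  have "act w (jucys_murphy k y) = (\<Sum>i\<in>{1..<k}. act w (act (transpose i k) y))"
    unfolding jucys_murphy_def using w t assms act_in by (intro act_sum) auto
  also have "\<dots> = (\<Sum>i\<in>{1..<k}. act (transpose (w i) k) (act w y))"
  proof (rule sum.cong[OF refl])
    fix i assume i: "i \<in> {1..<k}"
    then have "w i \<in> {1..<k}" using permutes_in_image[OF assms(2)] by blast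
    then show "act w (act (transpose i k) y) = act (transpose (w i) k) (act w y)"
      using act_comp[OF w t[OF i] assms(3)] act_comp[OF t w assms(3), of "w i"] e[of i] by simp
  qed
  also have "\<dots> = jucys_murphy k (act w y)"
    unfolding jucys_murphy_def by (rule sum.reindex_bij_betw[OF bw])
  finally show ?thesis by simp
qed

end

section \<open>The Young basis as a basis of weight vectors\<close>

context young_rep
begin

lemma std_tab: "standard_tableau lam T \<Longrightarrow> std_tab lam T n"
  by unfold_locales (use partition in auto)

text \<open>Induction on \<open>k\<close> through x_(k+1) = s x_k s + s. On the span of
  \<open>v T\<close> and \<open>v ?T\<close> the element x_k is diagonal with entries a, b and s has
  rows (d, r), (r, -d); the relations d (b - a) = 1 and r^2 = 1 - d^2 make the result act on
  \<open>v T\<close> by b. If the exchanged filling is not standard, then s acts on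
  \<open>v T\<close> by d = b - a, which is 1 or -1.\<close>

lemma jucys_murphy_basis:
  assumes "standard_tableau lam T" "k \<in> {1..n}"
  shows "jucys_murphy k (v T) = scale (of_int (content lam T k)) (v T)"
proof -
  have "1 \<le> k \<Longrightarrow> standard_tableau lam T \<Longrightarrow> k \<le> n \<Longrightarrow> ?thesis"
  proof (induction k arbitrary: T rule: dec_induct)
    case base
    interpret std_tab lam T n using std_tab base by blast
    show ?case using content_one base by (simp add: jucys_murphy_def)
  next
    case (step k)
    interpret std_tab lam T n using std_tab step by blast
    let ?s = "transpose k (k + 1)" and ?T = "swap_entries k T"
    define a b where "a = content lam T k" and "b = content lam T (k + 1)"
    define d where "d = 1 / real_of_int (b - a)"
    define r where "r = sqrt (1 - d\<^sup>2)"
    have k: "1 \<le> k" "k + 1 \<le> n" using step by auto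
    have ab: "b \<noteq> a" using content_Suc_neq[OF k] by (simp add: a_def b_def)
    have s: "?s permutes {1..n}" using transpose_permutes[of "k + 1" k] k by auto
    have vT: "v T \<in> V" using basis_in step.prems by blast
    have JT: "jucys_murphy k (v T) = scale (of_int a) (v T)"
      using step.IH step.prems k unfolding a_def by simp
    have act_T: "act ?s (v T) = scale (of_real d) (v T) +
        scale (of_real r) (if standard_tableau lam ?T then v ?T else 0)"
      unfolding r_def
      by (rule young_formula) (use step.prems k in \<open>auto simp: d_def a_def b_def\<close>)
    have da: "of_real d * (of_int b - of_int a) = (1::complex)"
    proof -
      have "d * (real_of_int b - real_of_int a) = 1" using ab by (simp add: d_def)
      then have "complex_of_real (d * (real_of_int b - real_of_int a)) = 1" by simp
      then show ?thesis by simp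
    qed
    have "jucys_murphy (k + 1) (v T) = scale (of_int b) (v T)"
    proof (cases "standard_tableau lam ?T")
      case True
      then have vT': "v ?T \<in> V" using basis_in by blast
      have c1: "content lam ?T k = b" "content lam ?T (k + 1) = a"
        using content_swap[OF k, of k] content_swap[OF k, of "k + 1"] k by (auto simp: a_def b_def)
      have JT': "jucys_murphy k (v ?T) = scale (of_int b) (v ?T)"
        using step.IH[OF True] k c1 by simp
      have swap2: "swap_entries k ?T = T" by (simp add: swap_entries_def flip: comp_assoc)
      have act_T': "act ?s (v ?T) = scale (of_real (- d)) (v ?T) + scale (of_real r) (v T)"
      proof -
        have "- d = 1 / real_of_int (content lam ?T (k + 1) - content lam ?T k)"
          unfolding c1 using ab by (simp add: d_def field_simps)
        from young_formula[OF True k this] show ?thesis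
          using step.prems by (simp add: swap2 r_def)
      qed
      \<comment> \<open>The contents are distinct integers, which gives d^2 \<le> 1; a real square
        root squares back to its argument only if that argument is nonnegative.\<close>
      have "0 < (b - a)\<^sup>2" using ab by simp
      then have "1 \<le> (b - a)\<^sup>2" by linarith
      then have "1 \<le> (real_of_int (b - a))\<^sup>2" by (metis of_int_1_le_iff of_int_power)
      then have "d\<^sup>2 \<le> 1" unfolding d_def power_one_over
        by (intro divide_le_eq_1[THEN iffD2]) auto
      then have "r * r = 1 - d * d" by (simp add: r_def power2_eq_square)
      then have rr: "complex_of_real r * of_real r = 1 - of_real d * of_real d"
        by (metis of_real_1 of_real_diff of_real_mult)
      have "act ?s (v T) = scale (of_real d) (v T) + scale (of_real r) (v ?T)"
        using act_T True by simp
      then have "jucys_murphy k (act ?s (v T)) =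
          scale (of_real d * of_int a) (v T) + scale (of_real r * of_int b) (v ?T)"
        using k vT vT' by (simp add: jucys_murphy_add jucys_murphy_scale V_scale JT JT')
      then have "jucys_murphy (k + 1) (v T) =
          scale (of_real d * of_int a) (act ?s (v T)) + scale (of_real r * of_int b) (act ?s (v ?T))
            + act ?s (v T)"
        using jucys_murphy_Suc[OF k vT] s vT vT' by (simp add: act_add act_scale V_scale)
      also have "\<dots> =
          scale (of_real d * of_int a * of_real d + of_real r * of_int b * of_real r + of_real d) (v T)
          + scale (of_real d * of_int a * of_real r - of_real r * of_int b * of_real d + of_real r) (v ?T)"
        using act_T act_T' True
        by (simp add: scale_right_distrib scale_left_distrib scale_left_diff_distrib
            scale_right_diff_distrib)
      also have "of_real d * of_int a * of_real r - of_real r * of_int b * of_real d + of_real r = (0::complex)"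
        using da by algebra
      also have "of_real d * of_int a * of_real d + of_real r * of_int b * of_real r + of_real d = (of_int b :: complex)"
        using da rr by algebra
      finally show ?thesis by simp
    next
      case False
      then have abs: "\<bar>b - a\<bar> = 1" using swap_not_standard[OF k] by (simp add: a_def b_def)
      then have "b - a = 1 \<or> b - a = -1" by linarith
      then have d: "d = real_of_int (b - a)" "d\<^sup>2 = 1" by (auto simp: d_def simp del: of_int_diff)
      then have act_T: "act ?s (v T) = scale (of_int (b - a)) (v T)"
        using act_T False by (simp add: r_def)
      have "(b - a) * (b - a) = 1" using \<open>b - a = 1 \<or> b - a = -1\<close> by auto
      then have e: "of_int (b - a) * of_int (b - a) = (1::complex)" by (metis of_int_1 of_int_mult)
      have "jucys_murphy (k + 1) (v T) =
          scale (of_int (b - a) * of_int a * of_int (b - a) + of_int (b - a)) (v T)"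
        using jucys_murphy_Suc[OF k vT] s vT k
        unfolding act_T
        by (simp add: jucys_murphy_scale JT act_scale V_scale act_T[unfolded Suc_eq_plus1[symmetric]] mult_ac del: of_int_diff
            flip: scale_left_distrib)
      also have "of_int (b - a) * of_int a * of_int (b - a) + of_int (b - a) = (of_int b :: complex)"
        using e unfolding of_int_diff by algebra
      finally show ?thesis .
    qed
    then show ?case by (simp add: b_def)
  qed
  then show ?thesis using assms by auto
qed

lemma eq_zeroI:
  assumes "y \<in> V" "\<And>T. standard_tableau lam T \<Longrightarrow> ip y (v T) = 0"
  shows "y = 0"
proof (rule ccontr)
  assume "y \<noteq> 0"
  have "subspace {z \<in> V. ip y z = 0}"
    using assms(1) subspace_V
    by (auto simp: subspace_def ip_zero_right ip_add_right ip_scale_right)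
  moreover have "v ` {T. standard_tableau lam T} \<subseteq> {z \<in> V. ip y z = 0}"
    using assms(2) basis_in by auto
  ultimately have "V \<subseteq> {z \<in> V. ip y z = 0}"
    using span_minimal basis_span by blast
  then have "ip y y = 0" using assms(1) by blast
  then show False using ip_pos[OF assms(1) \<open>y \<noteq> 0\<close>] by simp
qed

text \<open>Eigenvectors of a self-adjoint operator for different eigenvalues are orthogonal. In
  this form a nonzero component along \<open>v T\<close> reveals the content.\<close>

lemma weight_orthogonal:
  assumes "y \<in> V" "k \<in> {1..n}" "jucys_murphy k y = scale a y" "standard_tableau lam T"
    and "ip y (v T) \<noteq> 0"
  shows "a = of_int (content lam T k)"
proof -
  have vT: "v T \<in> V" using basis_in assms by blast
  have "a * ip y (v T) = ip (jucys_murphy k y) (v T)"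
    unfolding assms(3) using assms(1) vT by (simp add: ip_scale)
  also have "\<dots> = of_int (content lam T k) * ip y (v T)"
    using assms(1,2,4) vT by (simp add: jucys_murphy_self_adjoint jucys_murphy_basis ip_scale_right)
  finally show ?thesis using assms(5) by simp
qed

end

section \<open>Diagonal matrix coefficients of one Young basis vector\<close>

locale young_vector = young_rep scale n V act ip lam v
  for scale :: "complex \<Rightarrow> 'v::ab_group_add \<Rightarrow> 'v" and n V act ip lam v +
  fixes T :: "nat \<times> nat \<Rightarrow> nat"
  assumes T: "standard_tableau lam T"
begin

sublocale std_tab lam T n
  using std_tab T by blast

abbreviation "vT \<equiv> v T"

definition cT :: "nat \<Rightarrow> complex" where
  "cT k = of_int (content lam T k)"

lemma cnj_cT: "cnj (cT k) = cT k"
  by (simp add: cT_def)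

lemma vT: "vT \<in> V"
  using basis_in T by blast

lemma vT_eigen: "k \<in> {1..n} \<Longrightarrow> jucys_murphy k vT = scale (cT k) vT"
  using jucys_murphy_basis[OF T] by (simp add: cT_def)

text \<open>The element M_m of the overview. The inverse appears because (s v, v) is attached to the
  inverse of s in the matrix element.\<close>

definition matrix_coeff :: "nat \<Rightarrow> (nat \<Rightarrow> nat) \<Rightarrow> complex" where
  "matrix_coeff m t = (if t permutes {1..m} then ip (act (inv t) vT) vT else 0)"

lemma matrix_coeff_zero: "matrix_coeff 0 = ga_basis id"
  using basis_orthonormal[OF T T] act_id[OF vT]
  by (auto simp: matrix_coeff_def ga_basis_def)

lemma perm_le: "m \<le> n \<Longrightarrow> w permutes {1..m} \<Longrightarrow> w permutes {1..n}"
  by (rule permutes_subset) auto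

lemma matrix_element_eq: "matrix_element n act ip vT = matrix_coeff n"
proof
  fix t
  have "matrix_element n act ip vT t =
      (\<Sum>s | s permutes {1..n}. if s = inv t \<and> t permutes {1..n} then ip (act s vT) vT else 0)"
    unfolding matrix_element_def
    by (rule sum.cong) (auto simp: ga_basis_def permutes_inv_inv permutes_inv)
  also have "\<dots> = matrix_coeff n t"
    by (auto simp: matrix_coeff_def finite_permutations permutes_inv sum.delta' if_distrib
        cong: if_cong)
  finally show "matrix_element n act ip vT t = matrix_coeff n t" .
qed

lemma matrix_coeff_translate:
  assumes "m \<le> n" "w permutes {1..m}" "t permutes {1..m}"
  shows "matrix_coeff m (t \<circ> w) = ip (act (inv t) vT) (act w vT)"
    and "matrix_coeff m (w \<circ> t) = ip (act (inv t) (act (inv w) vT)) vT"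
proof -
  have p: "w permutes {1..n}" "t permutes {1..n}" "inv w permutes {1..n}" "inv t permutes {1..n}"
    using perm_le assms permutes_inv by blast+
  have q: "(t \<circ> w) permutes {1..m}" "(w \<circ> t) permutes {1..m}"
    using permutes_compose assms by blast+
  show "matrix_coeff m (t \<circ> w) = ip (act (inv t) vT) (act w vT)"
    using q p act_comp[OF p(3) p(4) vT] act_adjoint[OF p(3) act_in[OF p(4) vT] vT]
    by (simp add: matrix_coeff_def o_inv_distrib[OF permutes_bij permutes_bij] permutes_inv_inv)
  show "matrix_coeff m (w \<circ> t) = ip (act (inv t) (act (inv w) vT)) vT"
    using q p act_comp[OF p(4) p(3) vT]
    by (simp add: matrix_coeff_def o_inv_distrib[OF permutes_bij permutes_bij])
qed

lemma perm_transpose_iff: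
  fixes i k m :: nat
  assumes "i \<in> {1..<k}" "k \<le> m"
  shows "(t \<circ> transpose i k) permutes {1..m} \<longleftrightarrow> t permutes {1..m}"
    and "(transpose i k \<circ> t) permutes {1..m} \<longleftrightarrow> t permutes {1..m}"
proof -
  have s: "transpose i k permutes {1..m}" using assms by (intro permutes_swap_id) auto
  have "t = (t \<circ> transpose i k) \<circ> transpose i k" "t = transpose i k \<circ> (transpose i k \<circ> t)"
    by (simp_all add: comp_assoc) (simp flip: comp_assoc)
  then show "(t \<circ> transpose i k) permutes {1..m} \<longleftrightarrow> t permutes {1..m}"
    "(transpose i k \<circ> t) permutes {1..m} \<longleftrightarrow> t permutes {1..m}"
    using permutes_compose[OF s] permutes_compose[OF _ s] by metis+
qed

text \<open>A transposition to the right of \<open>t\<close> moves to the second slot of the inner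
  product, one to the left of \<open>t\<close> stays in the first; in both slots the sum becomes x_k
  applied to v_T. Contents are real, so the conjugation has no effect, and for \<open>k\<close> at
  most \<open>m\<close> the translations respect the truncation to S_m.\<close>

lemma matrix_coeff_eigen:
  assumes "m \<le> n" "k \<in> {1..m}"
  shows "(\<Sum>i\<in>{1..<k}. matrix_coeff m (t \<circ> transpose i k)) = cT k * matrix_coeff m t"
    and "(\<Sum>i\<in>{1..<k}. matrix_coeff m (transpose i k \<circ> t)) = cT k * matrix_coeff m t"
proof -
  have k: "k \<in> {1..n}" "k \<le> n" using assms by auto
  have s: "transpose i k permutes {1..m}" "transpose i k permutes {1..n}" if "i \<in> {1..<k}" for i
    using assms that by (auto intro!: permutes_swap_id)
  have "(\<Sum>i\<in>{1..<k}. matrix_coeff m (t \<circ> transpose i k)) = cT k * matrix_coeff m t \<and>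
    (\<Sum>i\<in>{1..<k}. matrix_coeff m (transpose i k \<circ> t)) = cT k * matrix_coeff m t"
  proof (cases "t permutes {1..m}")
    case True
    have it: "inv t permutes {1..n}" using True perm_le assms permutes_inv by blast
    have "(\<Sum>i\<in>{1..<k}. matrix_coeff m (t \<circ> transpose i k)) =
        (\<Sum>i\<in>{1..<k}. ip (act (inv t) vT) (act (transpose i k) vT))"
      by (rule sum.cong) (use s(1) matrix_coeff_translate(1)[OF assms(1) _ True] in auto)
    also have "\<dots> = ip (act (inv t) vT) (jucys_murphy k vT)"
      unfolding jucys_murphy_def using s vT it act_in by (subst ip_sum_right) auto
    also have "\<dots> = cT k * matrix_coeff m t"
      using True it k vT act_in by (simp add: vT_eigen ip_scale_right cnj_cT matrix_coeff_def)
    finally have 1: "(\<Sum>i\<in>{1..<k}. matrix_coeff m (t \<circ> transpose i k)) = cT k * matrix_coeff m t" .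
    have "(\<Sum>i\<in>{1..<k}. matrix_coeff m (transpose i k \<circ> t)) =
        (\<Sum>i\<in>{1..<k}. ip (act (inv t) (act (transpose i k) vT)) vT)"
      by (rule sum.cong) (use s(1) matrix_coeff_translate(2)[OF assms(1) _ True] in auto)
    also have "\<dots> = ip (\<Sum>i\<in>{1..<k}. act (inv t) (act (transpose i k) vT)) vT"
      using s vT it act_in by (subst ip_sum_left) auto
    also have "\<dots> = ip (act (inv t) (jucys_murphy k vT)) vT"
      unfolding jucys_murphy_def using s vT it act_in by (subst act_sum) auto
    also have "\<dots> = cT k * matrix_coeff m t"
      using True it k vT act_in by (simp add: vT_eigen ip_scale act_scale matrix_coeff_def)
    finally show ?thesis using 1 by simp
  next
    case False
    then have "matrix_coeff m t = 0" by (simp add: matrix_coeff_def)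
    moreover have "matrix_coeff m (t \<circ> transpose i k) = 0" "matrix_coeff m (transpose i k \<circ> t) = 0"
      if "i \<in> {1..<k}" for i
      using False perm_transpose_iff[OF that, of m t] assms by (auto simp: matrix_coeff_def)
    ultimately show ?thesis by simp
  qed
  then show "(\<Sum>i\<in>{1..<k}. matrix_coeff m (t \<circ> transpose i k)) = cT k * matrix_coeff m t"
    "(\<Sum>i\<in>{1..<k}. matrix_coeff m (transpose i k \<circ> t)) = cT k * matrix_coeff m t"
    by auto
qed

text \<open>By Schur orthogonality this is p! divided by the dimension of the irreducible S_p-module
  generated by v_T. It is the scalar by which M_p multiplies v_T and, up to conjugation, M_m for m
  at least p.\<close>

definition coeff_norm :: "nat \<Rightarrow> complex" where
  "coeff_norm p = (\<Sum>w | w permutes {1..p}. matrix_coeff p w * cnj (matrix_coeff p w))"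

lemma matrix_coeff_inv:
  assumes "m \<le> n" "w permutes {1..m}"
  shows "matrix_coeff m (inv w) = cnj (matrix_coeff m w)" "ip (act w vT) vT = matrix_coeff m (inv w)"
proof -
  have w: "w permutes {1..n}" "inv w permutes {1..n}" using assms perm_le permutes_inv by blast+
  show 1: "ip (act w vT) vT = matrix_coeff m (inv w)"
    using assms by (simp add: matrix_coeff_def permutes_inv permutes_inv_inv)
  have "ip (act w vT) vT = cnj (ip (act (inv w) vT) vT)"
    using act_adjoint[OF w(1) vT vT] ip_cnj[OF act_in[OF w(2) vT] vT] by simp
  then show "matrix_coeff m (inv w) = cnj (matrix_coeff m w)"
    using assms 1 by (simp add: matrix_coeff_def)
qed

lemma coeff_norm_nonzero: "p \<le> n \<Longrightarrow> coeff_norm p \<noteq> 0"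
proof
  assume p: "p \<le> n" and "coeff_norm p = 0"
  then have "(\<Sum>w | w permutes {1..p}. (norm (matrix_coeff p w))\<^sup>2) = 0"
    by (simp add: coeff_norm_def flip: complex_norm_square of_real_sum of_real_power)
  then have "norm (matrix_coeff p id) = 0"
    by (simp add: sum_nonneg_eq_0_iff finite_permutations permutes_id)
  then show False
    using basis_orthonormal[OF T T] act_id[OF vT] by (simp add: matrix_coeff_def permutes_id)
qed

text \<open>The vector on the left has the same Jucys--Murphy eigenvalues as v_T: for
  \<open>k\<close> at most \<open>p\<close> because M_p is an eigenvector under left multiplication,
  for larger \<open>k\<close> because x_k commutes with S_p. As the contents determine the tableau,
  it is a multiple of v_T, and pairing with v_T gives the factor.\<close>

lemma matrix_coeff_fixes_vT:
  assumes p: "p \<le> n"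
  shows "(\<Sum>w | w permutes {1..p}. scale (matrix_coeff p w) (act w vT)) = scale (coeff_norm p) vT"
    (is "?P = _")
proof -
  have fin: "finite {w. w permutes {1..p}}" by (simp add: finite_permutations)
  have aw: "act w vT \<in> V" if "w permutes {1..p}" for w using perm_le[OF p that] act_in vT by blast
  have P: "?P \<in> V" using aw by (intro V_sum V_scale) auto
  have eig: "jucys_murphy k ?P = scale (cT k) ?P" if k: "k \<in> {1..n}" for k
  proof -
    have t: "transpose i k permutes {1..n}" if "i \<in> {1..<k}" for i
      using transpose_permutes k that by auto
    have "jucys_murphy k ?P = (\<Sum>w | w permutes {1..p}. scale (matrix_coeff p w) (jucys_murphy k (act w vT)))"
    proof -
      have "act (transpose i k) ?P = (\<Sum>w | w permutes {1..p}. scale (matrix_coeff p w) (act (transpose i k) (act w vT)))"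
        if "i \<in> {1..<k}" for i
        using t[OF that] aw by (subst act_sum) (auto simp: V_scale act_scale intro!: sum.cong)
      then show ?thesis
        unfolding jucys_murphy_def scale_sum_right by (subst sum.swap) (rule sum.cong, auto)
    qed
    also have "\<dots> = scale (cT k) ?P"
    proof (cases "k \<le> p")
      case True
      then have tp: "transpose i k permutes {1..p}" if "i \<in> {1..<k}" for i
        using k that by (intro permutes_swap_id) auto
      have "(\<Sum>w | w permutes {1..p}. scale (matrix_coeff p w) (jucys_murphy k (act w vT))) =
          (\<Sum>i\<in>{1..<k}. \<Sum>w | w permutes {1..p}. scale (matrix_coeff p w) (act (transpose i k \<circ> w) vT))"
        unfolding jucys_murphy_def scale_sum_right
        by (subst sum.swap) (use act_comp[OF t perm_le[OF p] vT] in \<open>auto intro!: sum.cong\<close>)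
      also have "\<dots> = (\<Sum>i\<in>{1..<k}. \<Sum>w | w permutes {1..p}. scale (matrix_coeff p (transpose i k \<circ> w)) (act w vT))"
      proof (rule sum.cong[OF refl])
        fix i assume i: "i \<in> {1..<k}"
        show "(\<Sum>w | w permutes {1..p}. scale (matrix_coeff p w) (act (transpose i k \<circ> w) vT)) =
           (\<Sum>w | w permutes {1..p}. scale (matrix_coeff p (transpose i k \<circ> w)) (act w vT))"
          by (rule sum.reindex_bij_witness[where i = "\<lambda>w. transpose i k \<circ> w" and j = "\<lambda>w. transpose i k \<circ> w"])
            (use permutes_compose[OF _ tp[OF i]] in \<open>auto simp flip: comp_assoc\<close>)
      qed
      also have "\<dots> = (\<Sum>w | w permutes {1..p}. scale (\<Sum>i\<in>{1..<k}. matrix_coeff p (transpose i k \<circ> w)) (act w vT))"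
        unfolding scale_sum_left by (rule sum.swap)
      also have "\<dots> = scale (cT k) ?P"
        unfolding scale_sum_right using matrix_coeff_eigen(2)[OF p, of k] True k by simp
      finally show ?thesis .
    next
      case False
      have "jucys_murphy k (act w vT) = scale (cT k) (act w vT)" if "w permutes {1..p}" for w
      proof -
        have "w permutes {1..<k}" by (rule permutes_subset[OF that]) (use False in auto)
        then show ?thesis
          using jucys_murphy_commute[of k w vT] k vT perm_le[OF p that] by (simp add: vT_eigen act_scale)
      qed
      then show ?thesis unfolding scale_sum_right by (simp add: mult.commute)
    qed
    finally show ?thesis .
  qed
  have norm: "ip ?P vT = coeff_norm p"
    unfolding coeff_norm_def using aw vT
    by (subst ip_sum_left) (auto simp: V_scale ip_scale matrix_coeff_inv[OF p] intro!: sum.cong)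
  have neg: "scale (- coeff_norm p) vT \<in> V" using vT by (intro V_scale)
  have "?P + scale (- coeff_norm p) vT = 0"
  proof (rule eq_zeroI)
    show "?P + scale (- coeff_norm p) vT \<in> V" using P neg V_add by blast
    fix T' assume T': "standard_tableau lam T'"
    have vT': "v T' \<in> V" using basis_in T' by blast
    show "ip (?P + scale (- coeff_norm p) vT) (v T') = 0"
    proof (cases "T' = T")
      case True
      then show ?thesis
        using ip_add[OF P neg vT] ip_scale[OF vT vT, of "- coeff_norm p"] norm
          basis_orthonormal[OF T T] by simp
    next
      case False
      have "ip ?P (v T') = 0"
      proof (rule ccontr)
        assume "ip ?P (v T') \<noteq> 0"
        then have "cT k = of_int (content lam T' k)" if "k \<in> {1..n}" for k
          using weight_orthogonal[OF P that eig[OF that] T'] by blast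
        then have "content lam T k = content lam T' k" if "k \<in> {1..n}" for k
          using that unfolding cT_def by (metis of_int_eq_iff)
        then show False using std_tab_eqI[OF std_tab[OF T] std_tab[OF T']] False by blast
      qed
      then show ?thesis
        using ip_add[OF P neg vT'] ip_scale[OF vT vT', of "- coeff_norm p"] False
          basis_orthonormal[OF T T'] by simp
    qed
  qed
  then show ?thesis by (simp add: scale_minus_left)
qed

text \<open>The left side is the coefficient of \<open>t\<close> in M_m M_p. Moved into the second
  slot of the inner product, M_p meets v_T and acts by a scalar. With p = m - 1 the scalar is the
  same for M_(m-1) and M_m, which is what allows the comparison in
  \<open>fusion_step\<close>.\<close>

lemma matrix_coeff_convolution:
  assumes "p \<le> m" "m \<le> n"
  shows "(\<Sum>w | w permutes {1..p}. matrix_coeff p w * matrix_coeff m (t \<circ> inv w)) =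
    cnj (coeff_norm p) * matrix_coeff m t"
proof (cases "t permutes {1..m}")
  case True
  have p: "p \<le> n" using assms by simp
  have it: "inv t permutes {1..n}" using True perm_le assms permutes_inv by blast
  have wm: "w permutes {1..m}" if "w permutes {1..p}" for w
    by (rule permutes_subset[OF that]) (use assms in auto)
  have aw: "act w vT \<in> V" if "w permutes {1..p}" for w using perm_le[OF p that] act_in vT by blast
  have at: "act (inv t) vT \<in> V" using act_in it vT by blast
  have "(\<Sum>w | w permutes {1..p}. matrix_coeff p w * matrix_coeff m (t \<circ> inv w)) =
      (\<Sum>w | w permutes {1..p}. matrix_coeff p (inv w) * matrix_coeff m (t \<circ> w))"
    by (rule sum.reindex_bij_witness[where i = inv and j = inv])
      (auto simp: permutes_inv permutes_inv_inv)
  also have "\<dots> = (\<Sum>w | w permutes {1..p}. ip (act (inv t) vT) (scale (matrix_coeff p w) (act w vT)))"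
    by (rule sum.cong) (use matrix_coeff_inv(1)[OF p] matrix_coeff_translate(1)[OF assms(2) wm True]
        aw at in \<open>auto simp: ip_scale_right\<close>)
  also have "\<dots> = ip (act (inv t) vT) (\<Sum>w | w permutes {1..p}. scale (matrix_coeff p w) (act w vT))"
    by (rule ip_sum_right[symmetric]) (use aw at in \<open>auto intro: V_scale\<close>)
  also have "\<dots> = cnj (coeff_norm p) * matrix_coeff m t"
    unfolding matrix_coeff_fixes_vT[OF p] using True at vT by (simp add: ip_scale_right matrix_coeff_def)
  finally show ?thesis .
next
  case False
  have "\<not> (t \<circ> inv w) permutes {1..m}" if w: "w permutes {1..p}" for w
  proof
    assume "(t \<circ> inv w) permutes {1..m}"
    moreover have "w permutes {1..m}" by (rule permutes_subset[OF w]) (use assms in auto)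
    ultimately have "(t \<circ> inv w \<circ> w) permutes {1..m}" using permutes_compose by blast
    then show False using False by (simp add: comp_assoc permutes_inv_o[OF w])
  qed
  then show ?thesis using False by (simp add: matrix_coeff_def)
qed

text \<open>For \<open>g\<close> fixing \<open>m\<close> the vector \<open>\<Sum>w. X (g \<circ> s \<circ> w) w v\<^sub>T\<close>, \<open>s = (m - 1  m)\<close>, is an eigenvector of the
  Jucys--Murphy elements of \<open>m - 1\<close> and of \<open>m\<close> for the same eigenvalue, hence zero, because
  consecutive contents of a standard tableau differ.\<close>

lemma eigen_zero:
  fixes X :: "(nat \<Rightarrow> nat) \<Rightarrow> complex"
  assumes m: "m \<in> {1..n}"
    and supp: "\<And>t. X t \<noteq> 0 \<Longrightarrow> t permutes {1..m}"
    and restr: "\<And>t. t permutes {1..<m} \<Longrightarrow> X t = 0"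
    and left: "\<And>t. t permutes {1..n} \<Longrightarrow> (\<Sum>i\<in>{1..<m}. X (transpose i m \<circ> t)) = cT m * X t"
    and right: "\<And>t. t permutes {1..n} \<Longrightarrow>
      (\<Sum>w | w permutes {1..m - 1}. matrix_coeff (m - 1) w * X (t \<circ> inv w)) = \<kappa> * X t"
    and "\<kappa> \<noteq> 0"
  shows "X t = 0"
proof (rule ccontr)
  assume Xt: "X t \<noteq> 0"
  let ?p = "m - 1"
  have p: "?p \<le> n" and mn: "m \<le> n" and pm: "{1..?p} = {1..<m}" using m by auto
  have t: "t permutes {1..m}" using supp Xt by blast
  have tm: "t m \<noteq> m"
  proof
    assume "t m = m"
    then have "t permutes {1..<m}"
      using permutes_superset[OF t, of "{1..<m}"] by (metis atLeastAtMost_iff atLeastLessThan_iff order_le_less DiffE)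
    then show False using restr Xt by blast
  qed
  define j where "j = inv t m"
  have tj: "t j = m" using permutes_inverses(1)[OF t] by (simp add: j_def)
  have j: "j \<in> {1..<m}"
    using permutes_in_image[OF permutes_inv[OF t], of m] m tm tj by (auto simp: j_def le_less)
  then have m2: "m - 1 \<in> {1..<m}" by auto
  \<comment> \<open>The permutations of 1..m that move m form the single double coset S_(m-1) s
    S_(m-1). Here \<open>q\<close> brings the preimage \<open>j\<close> of \<open>m\<close> to
    \<open>m - 1\<close>, so that t = g s q with \<open>g\<close> and \<open>q\<close> fixing
    \<open>m\<close>.\<close>
  define q where "q = transpose j (m - 1)"
  define s where "s = transpose (m - 1) m"
  define g where "g = t \<circ> q \<circ> s"
  have q: "q permutes {1..?p}" unfolding q_def using j m2 by (intro permutes_swap_id) auto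
  have s: "s permutes {1..m}" unfolding s_def using m2 m by (intro permutes_swap_id) auto
  have qm: "q permutes {1..m}" by (rule permutes_subset[OF q]) auto
  have gm: "g permutes {1..m}" unfolding g_def using permutes_compose s qm t by blast
  have "g m = m" using tj m2 by (simp add: g_def s_def q_def)
  then have gp: "g permutes {1..?p}"
    using permutes_superset[OF gm, of "{1..?p}"] by (metis atLeastAtMost_iff atLeastLessThan_iff order_le_less DiffE pm)
  have t_eq: "t = g \<circ> s \<circ> q" by (simp add: g_def s_def q_def comp_assoc)
  have aw: "act w vT \<in> V" if "w permutes {1..?p}" for w using perm_le[OF p that] act_in vT by blast
  have wm: "w permutes {1..m}" if "w permutes {1..?p}" for w
    by (rule permutes_subset[OF that]) auto
  have gsw: "(g \<circ> s \<circ> w) permutes {1..n}" if "w permutes {1..?p}" for w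
    using perm_le[OF mn] permutes_compose[OF wm[OF that] permutes_compose[OF s gm]] by blast
  define S where "S = (\<Sum>w | w permutes {1..?p}. scale (X (g \<circ> s \<circ> w)) (act w vT))"
  have S: "S \<in> V" unfolding S_def using aw by (intro V_sum V_scale) auto
  have act_S: "act h S = (\<Sum>w | w permutes {1..?p}. scale (X (g \<circ> s \<circ> w)) (act h (act w vT)))"
    if "h permutes {1..n}" for h
    unfolding S_def using that aw by (subst act_sum) (auto simp: V_scale act_scale intro!: sum.cong)
  have eig_m: "jucys_murphy m S = scale (cT m) S"
  proof -
    have "jucys_murphy m S = (\<Sum>w | w permutes {1..?p}. scale (X (g \<circ> s \<circ> w)) (jucys_murphy m (act w vT)))"
      unfolding jucys_murphy_def scale_sum_right
      by (subst sum.swap) (rule sum.cong, use act_S transpose_permutes[OF mn] in auto)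
    also have "\<dots> = (\<Sum>w | w permutes {1..?p}. scale (X (g \<circ> s \<circ> w)) (scale (cT m) (act w vT)))"
      by (rule sum.cong)
        (use jucys_murphy_commute[OF mn _ vT] vT_eigen[OF m] pm act_scale[OF perm_le[OF p] vT] in auto)
    finally show ?thesis unfolding S_def scale_sum_right by (simp add: mult.commute)
  qed
  have eig_m1: "jucys_murphy (m - 1) S = scale (cT m) S"
  proof -
    have tp: "transpose i (m - 1) permutes {1..?p}" if "i \<in> {1..<m - 1}" for i
      using that by (intro permutes_swap_id) auto
    \<comment> \<open>Moving (i m-1) to the left across g s turns it into (g(i) m). For i < m - 1
      the values g(i) miss only g(m-1) among 1..m-1, and the missing term is X(g w), which vanishes
      by \<open>restr\<close>. So the sum is the full left action of x_m on
      \<open>X\<close>.\<close>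
    have X_sum: "(\<Sum>i\<in>{1..<m - 1}. X (g \<circ> s \<circ> (transpose i (m - 1) \<circ> w))) = cT m * X (g \<circ> s \<circ> w)"
      if w: "w permutes {1..?p}" for w
    proof -
      have conj: "g \<circ> s \<circ> (transpose i (m - 1) \<circ> w) = transpose (g i) m \<circ> (g \<circ> s \<circ> w)"
        if "i \<in> {1..<m - 1}" for i
      proof -
        have "(g \<circ> s) \<circ> transpose i (m - 1) = transpose (g i) m \<circ> (g \<circ> s)"
          using transpose_comp_perm[OF permutes_inj[OF permutes_compose[OF s gm]], of i "m - 1"] that \<open>g m = m\<close>
          by (auto simp: s_def transpose_def[of _ _ i] split: if_splits)
        then show ?thesis by (metis comp_assoc)
      qed
      have last: "transpose (g (m - 1)) m \<circ> (g \<circ> s \<circ> w) = g \<circ> w"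
      proof -
        have "g \<circ> s = transpose (g (m - 1)) m \<circ> g"
          using transpose_comp_perm[OF permutes_inj[OF gm], of "m - 1" m] \<open>g m = m\<close> by (simp add: s_def)
        then show ?thesis by (simp flip: comp_assoc)
      qed
      have "X (g \<circ> w) = 0" using restr permutes_compose[OF w gp] pm by simp
      moreover have "{1..<m} = insert (m - 1) {1..<m - 1}" using m2 by auto
      ultimately have "(\<Sum>i\<in>{1..<m}. X (transpose (g i) m \<circ> (g \<circ> s \<circ> w))) =
          (\<Sum>i\<in>{1..<m - 1}. X (g \<circ> s \<circ> (transpose i (m - 1) \<circ> w)))"
        using last by (auto simp: conj[unfolded One_nat_def] intro!: sum.cong)
      moreover have "(\<Sum>i\<in>{1..<m}. X (transpose (g i) m \<circ> (g \<circ> s \<circ> w))) =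
          (\<Sum>i\<in>{1..<m}. X (transpose i m \<circ> (g \<circ> s \<circ> w)))"
        by (rule sum.reindex_bij_betw[OF permutes_imp_bij[OF gp[unfolded pm]]])
      ultimately show ?thesis using left[OF gsw[OF w]] by simp
    qed
    have "jucys_murphy (m - 1) S = (\<Sum>i\<in>{1..<m - 1}. \<Sum>w | w permutes {1..?p}.
        scale (X (g \<circ> s \<circ> w)) (act (transpose i (m - 1) \<circ> w) vT))"
      unfolding jucys_murphy_def
      using act_S[OF transpose_permutes[OF p]] act_comp[OF transpose_permutes[OF p] perm_le[OF p] vT]
      by (auto intro!: sum.cong)
    also have "\<dots> = (\<Sum>i\<in>{1..<m - 1}. \<Sum>w | w permutes {1..?p}.
        scale (X (g \<circ> s \<circ> (transpose i (m - 1) \<circ> w))) (act w vT))"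
    proof (rule sum.cong[OF refl])
      fix i assume i: "i \<in> {1..<m - 1}"
      have tt: "transpose i (m - 1) \<circ> (transpose i (m - 1) \<circ> w) = w" for w :: "nat \<Rightarrow> nat"
        by (simp flip: comp_assoc)
      show "(\<Sum>w | w permutes {1..?p}. scale (X (g \<circ> s \<circ> w)) (act (transpose i (m - 1) \<circ> w) vT)) =
          (\<Sum>w | w permutes {1..?p}. scale (X (g \<circ> s \<circ> (transpose i (m - 1) \<circ> w))) (act w vT))"
        by (rule sum.reindex_bij_witness[where i = "\<lambda>w. transpose i (m - 1) \<circ> w"
              and j = "\<lambda>w. transpose i (m - 1) \<circ> w"])
          (use permutes_compose[OF _ tp[OF i]] in \<open>auto simp: comp_assoc tt[unfolded One_nat_def]\<close>)
    qed
    also have "\<dots> = (\<Sum>w | w permutes {1..?p}.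
        scale (\<Sum>i\<in>{1..<m - 1}. X (g \<circ> s \<circ> (transpose i (m - 1) \<circ> w))) (act w vT))"
      unfolding scale_sum_left by (rule sum.swap)
    also have "\<dots> = scale (cT m) S"
      unfolding S_def scale_sum_right by (rule sum.cong) (simp_all add: X_sum[unfolded One_nat_def])
    finally show ?thesis .
  qed
  have "S = 0"
  proof (rule eq_zeroI[OF S])
    fix T' assume T': "standard_tableau lam T'"
    interpret T': std_tab lam T' n using std_tab T' by blast
    show "ip S (v T') = 0"
    proof (rule ccontr)
      assume ne: "ip S (v T') \<noteq> 0"
      have m1: "m - 1 \<in> {1..n}" using m2 m by auto
      have "cT m = of_int (content lam T' m)" "cT m = of_int (content lam T' (m - 1))"
        using weight_orthogonal[OF S m eig_m T' ne] weight_orthogonal[OF S m1 eig_m1 T' ne] by auto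
      then have "content lam T' m = content lam T' (m - 1)" by (metis of_int_eq_iff)
      then show False using T'.content_Suc_neq[of "m - 1"] m2 m by simp
    qed
  qed
  \<comment> \<open>With t = g s q, the substitution of q composed with the inverse of w for w turns
    the convolution into the inner product of \<open>S\<close> with q v_T.\<close>
  have "\<kappa> * X t = (\<Sum>w | w permutes {1..?p}. matrix_coeff ?p w * X (t \<circ> inv w))"
    using right[OF perm_le[OF mn t]] by simp
  also have "\<dots> = (\<Sum>w | w permutes {1..?p}. matrix_coeff ?p (inv w \<circ> q) * X (g \<circ> s \<circ> w))"
  proof (rule sum.reindex_bij_witness[where i = "\<lambda>w. inv w \<circ> q" and j = "\<lambda>w. q \<circ> inv w"])
    have iq: "inv q = q" by (simp add: q_def)
    have qq: "q \<circ> q = id" by (simp add: q_def)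
    fix w assume "w \<in> {w. w permutes {1..?p}}"
    then have w: "w permutes {1..?p}" by simp
    have d1: "inv (q \<circ> inv w) = w \<circ> q"
      using o_inv_distrib[OF permutes_bij[OF q] permutes_bij[OF permutes_inv[OF w]]]
      by (simp add: iq permutes_inv_inv[OF w])
    have d2: "inv (inv w \<circ> q) = q \<circ> w"
      using o_inv_distrib[OF permutes_bij[OF permutes_inv[OF w]] permutes_bij[OF q]]
      by (simp add: iq permutes_inv_inv[OF w])
    show "inv (q \<circ> inv w) \<circ> q = w" by (simp add: d1 comp_assoc qq)
    show "q \<circ> inv w \<in> {w. w permutes {1..?p}}" using permutes_compose[OF permutes_inv[OF w] q] by simp
    show "q \<circ> inv (inv w \<circ> q) = w" by (simp add: d2 qq flip: comp_assoc)
    show "inv w \<circ> q \<in> {w. w permutes {1..?p}}" using permutes_compose[OF q permutes_inv[OF w]] by simp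
    show "matrix_coeff ?p (inv (q \<circ> inv w) \<circ> q) * X (g \<circ> s \<circ> (q \<circ> inv w)) =
        matrix_coeff ?p w * X (t \<circ> inv w)"
      by (simp add: d1 t_eq comp_assoc qq)
  qed
  also have "\<dots> = (\<Sum>w | w permutes {1..?p}. ip (scale (X (g \<circ> s \<circ> w)) (act w vT)) (act q vT))"
    by (rule sum.cong) (use matrix_coeff_translate(1)[OF p q permutes_inv] aw[OF q] aw in
        \<open>auto simp: permutes_inv_inv ip_scale\<close>)
  also have "\<dots> = ip S (act q vT)"
    unfolding S_def by (rule ip_sum_left[symmetric]) (use aw q in \<open>auto intro: V_scale\<close>)
  also have "\<dots> = 0" using \<open>S = 0\<close> aw[OF q] by (simp add: ip_zero_left)
  finally show False using Xt \<open>\<kappa> \<noteq> 0\<close> by simp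
qed

end

section \<open>One step of the fusion procedure\<close>

lemma sum_const_poly: "(\<Sum>i\<in>I. [:f i:]) = [:\<Sum>i\<in>I. f i:]"
  by (induction I rule: infinite_finite_induct) auto

lemma prod_linear_factors:
  fixes c :: "'a::comm_ring_1"
  assumes "finite A"
  shows "(\<Prod>i\<in>A. [:- f i, 1:]) =
    [:- c, 1:] ^ card {i \<in> A. f i = c} * (\<Prod>i\<in>{i \<in> A. f i \<noteq> c}. [:- f i, 1:])"
proof -
  have "A = {i \<in> A. f i = c} \<union> {i \<in> A. f i \<noteq> c}" by auto
  then have "(\<Prod>i\<in>A. [:- f i, 1:]) =
      (\<Prod>i\<in>{i \<in> A. f i = c}. [:- f i, 1:]) * (\<Prod>i\<in>{i \<in> A. f i \<noteq> c}. [:- f i, 1:])"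
    using assms by (subst prod.union_disjoint[symmetric]) auto
  then show ?thesis by simp
qed

context young_vector
begin

text \<open>Since (u - c_i)^2 - 1 = (u - (c_i + 1)) (u - (c_i - 1)), the zeros at c_m come from the
  two neighbouring diagonals, and from u if c_m = 0. With r earlier entries on the diagonal of m,
  the order 2 r + 1 pays r for the factor D in the resolvent identity, r for the power to be split
  off the numerator, and 1 for the eigenvector equation.\<close>

lemma content_factor_dvd:
  assumes m: "m \<in> {1..n}"
  defines "u \<equiv> [:0, 1:]" and "a \<equiv> \<lambda>i. [:cT i:]"
  shows "[:- cT m, 1:] ^ (2 * card {i \<in> {1..<m}. cT i = cT m} + 1) dvd
    u * (\<Prod>i\<in>{1..<m}. (u - a i)\<^sup>2 - 1)"
proof -
  let ?L = "[:- cT m, 1:]"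
  define N where "N a = card {k \<in> {1..<m}. content lam T k = a}" for a
  have card: "card {i \<in> {1..<m}. cT i = cT m} = N (content lam T m)"
    "card {i \<in> {1..<m}. cT i + 1 = cT m} = N (content lam T m - 1)"
    "card {i \<in> {1..<m}. cT i - 1 = cT m} = N (content lam T m + 1)"
  proof -
    have e1: "(of_int x + 1 = (of_int y :: complex)) = (x = y - 1)" for x y :: int
    proof -
      have "(of_int x + 1 = (of_int y :: complex)) = (of_int (x + 1) = (of_int y :: complex))"
        by (simp only: of_int_add of_int_1)
      also have "\<dots> = (x = y - 1)" unfolding of_int_eq_iff by linarith
      finally show ?thesis .
    qed
    have e2: "(of_int x - 1 = (of_int y :: complex)) = (x = y + 1)" for x y :: int
    proof -
      have "(of_int x - 1 = (of_int y :: complex)) = (of_int (x - 1) = (of_int y :: complex))"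
        by (simp only: of_int_diff of_int_1)
      also have "\<dots> = (x = y + 1)" unfolding of_int_eq_iff by linarith
      finally show ?thesis .
    qed
    show "card {i \<in> {1..<m}. cT i = cT m} = N (content lam T m)"
      "card {i \<in> {1..<m}. cT i + 1 = cT m} = N (content lam T m - 1)"
      "card {i \<in> {1..<m}. cT i - 1 = cT m} = N (content lam T m + 1)"
      by (simp_all add: N_def cT_def e1 e2)
  qed
  have split: "(u - a i)\<^sup>2 - 1 = [:- (cT i + 1), 1:] * [:- (cT i - 1), 1:]" for i
    by (simp add: u_def a_def power2_eq_square one_pCons algebra_simps)
  have "?L ^ N (content lam T m - 1) dvd (\<Prod>i\<in>{1..<m}. [:- (cT i + 1), 1:])"
    unfolding prod_linear_factors[OF finite_atLeastLessThan, of "\<lambda>i. cT i + 1" 1 m "cT m"] card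
    by (rule dvd_triv_left)
  moreover have "?L ^ N (content lam T m + 1) dvd (\<Prod>i\<in>{1..<m}. [:- (cT i - 1), 1:])"
    unfolding prod_linear_factors[OF finite_atLeastLessThan, of "\<lambda>i. cT i - 1" 1 m "cT m"] card
    by (rule dvd_triv_left)
  moreover have "?L ^ (if content lam T m = 0 then 1 else 0) dvd u"
    by (simp add: u_def cT_def)
  ultimately have "?L ^ (if content lam T m = 0 then 1 else 0) *
      (?L ^ N (content lam T m - 1) * ?L ^ N (content lam T m + 1)) dvd
      u * (\<Prod>i\<in>{1..<m}. (u - a i)\<^sup>2 - 1)"
    unfolding split prod.distrib by (intro mult_dvd_mono)
  moreover have "2 * N (content lam T m) + 1 \<le> (if content lam T m = 0 then 1 else 0) +
      (N (content lam T m - 1) + N (content lam T m + 1))"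
    using content_multiplicity[OF m refl] unfolding N_def by linarith
  ultimately show ?thesis
    unfolding card power_add[symmetric] using le_imp_power_dvd dvd_trans by blast
qed

text \<open>Here \<open>r\<close> is the order of the zero of \<open>D\<close> at c_m, and
  \<open>G\<close> and \<open>D'\<close> are what remains of numerator and denominator after
  cancelling it. The quotient of their values at c_m is M_m.\<close>

lemma fusion_step:
  assumes m: "m \<in> {1..n}"
  defines "u \<equiv> [:0, 1:]" and "a \<equiv> \<lambda>i. [:cT i:]"
  defines "F \<equiv> ascending_prod u a m (m - 1) (\<lambda>t. [:matrix_coeff (m - 1) t:])"
    and "D \<equiv> \<Prod>i\<in>{1..<m}. u - a i"
  obtains r D' G where "D = [:- cT m, 1:] ^ r * D'" "poly D' (cT m) \<noteq> 0"
    "\<And>t. F t = [:- cT m, 1:] ^ r * G t"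
    "\<And>t. poly (G t) (cT m) = poly D' (cT m) * matrix_coeff m t"
proof -
  define c where "c = cT m"
  define L where "L = [:- c, 1:]"
  define r where "r = card {i \<in> {1..<m}. cT i = c}"
  define D' where "D' = (\<Prod>i\<in>{i \<in> {1..<m}. cT i \<noteq> c}. [:- cT i, 1:])"
  define \<Psi> where "\<Psi> = matrix_coeff (m - 1)"
  define \<kappa> where "\<kappa> = cnj (coeff_norm (m - 1))"
  have L0: "L \<noteq> 0" and Lc: "poly L c = 0" and dL: "pderiv L = 1"
    by (simp_all add: L_def pderiv_pCons)
  have mn: "m \<le> n" "m - 1 \<le> n" and pm: "{1..m - 1} = {1..<m}" using m by auto
  have c_real: "c \<in> \<real>" by (simp add: c_def cT_def)
  have D: "D = L ^ r * D'"
    using prod_linear_factors[of "{1..<m}" cT c]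
    by (simp add: D_def D'_def L_def r_def u_def a_def)
  have D'c: "poly D' c \<noteq> 0" by (auto simp: D'_def poly_prod)
  obtain K where K: "u * (\<Prod>i\<in>{1..<m}. (u - a i)\<^sup>2 - 1) = L ^ (2 * r + 1) * K"
    using content_factor_dvd[OF m] unfolding u_def a_def L_def c_def r_def by (auto elim: dvdE)
  have supp_\<Psi>: "\<Psi> t \<noteq> 0 \<Longrightarrow> t permutes {1..<m}" for t
    unfolding \<Psi>_def matrix_coeff_def pm by (auto split: if_splits)
  have resolvent: "D' * (u * F t - (\<Sum>i\<in>{1..<m}. F (transpose i m \<circ> t))) = L ^ (r + 1) * K * [:\<Psi> t:]" for t
  proof -
    have "D * (u * F t - (\<Sum>i\<in>{1..<m}. F (transpose i m \<circ> t))) =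
        u * (\<Prod>i\<in>{1..<m}. (u - a i)\<^sup>2 - 1) * [:\<Psi> t:]"
      unfolding D_def F_def \<Psi>_def
    proof (rule ascending_prod_resolvent)
      fix i t assume "i \<in> {1..<m}"
      then have "(\<Sum>l\<in>{1..<i}. matrix_coeff (m - 1) (t \<circ> transpose l i)) = cT i * matrix_coeff (m - 1) t"
        by (intro matrix_coeff_eigen(1) mn) auto
      then show "(\<Sum>l\<in>{1..<i}. [:matrix_coeff (m - 1) (t \<circ> transpose l i):]) = a i * [:matrix_coeff (m - 1) t:]"
        unfolding sum_const_poly by (simp add: a_def)
    next
      fix t
      show "(\<Sum>i\<in>{1..<m}. [:matrix_coeff (m - 1) (transpose i m \<circ> t):]) =
          (\<Sum>i\<in>{1..<m}. [:matrix_coeff (m - 1) (t \<circ> transpose i m):])"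
        unfolding sum_const_poly
        using sum_transpose_commute[of "matrix_coeff (m - 1)" m t] supp_\<Psi>[unfolded \<Psi>_def] by simp
    qed
    then have "L ^ r * (D' * (u * F t - (\<Sum>i\<in>{1..<m}. F (transpose i m \<circ> t)))) =
        L ^ r * (L ^ (r + 1) * K * [:\<Psi> t:])"
      unfolding K D by (simp only: mult.assoc power_add mult_2 power_one_right)
    then show ?thesis using L0 by (metis mult_left_cancel power_not_zero)
  qed
  have F_supp: "t permutes {1..m}" if "F t \<noteq> 0" for t
  proof (rule ascending_prod_zero_outside[of "\<lambda>t. [:\<Psi> t:]" "{1..m}" "m - 1" m u a t])
    show "s permutes {1..m}" if "[:\<Psi> s:] \<noteq> 0" for s
      by (rule permutes_subset[OF supp_\<Psi>]) (use that in auto)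
    show "ascending_prod u a m (m - 1) (\<lambda>t. [:\<Psi> t:]) t \<noteq> 0" using that by (simp add: F_def \<Psi>_def)
  qed (use m in auto)
  \<comment> \<open>With L^j split off, the relation keeps the factor L^(r-j+1) on the right. Its
    value at \<open>c\<close> is the eigenvector equation; its derivative puts G(c) into the image
    of c - x_m, up to a multiple of \<open>\<Psi>\<close> that appears only for j = r.\<close>
  have eqs: "(\<Sum>i\<in>{1..<m}. poly (G (transpose i m \<circ> t)) c) = c * poly (G t) c"
    "poly D' c * (poly (G t) c + c * poly (pderiv (G t)) c
        - (\<Sum>i\<in>{1..<m}. poly (pderiv (G (transpose i m \<circ> t))) c)) =
      (if j = r then poly K c * \<Psi> t else 0)"
    if j: "j \<le> r" and G: "\<And>t. F t = L ^ j * G t" for j G t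
  proof -
    let ?H = "\<lambda>t. u * G t - (\<Sum>i\<in>{1..<m}. G (transpose i m \<circ> t))"
    have "L ^ j * (D' * ?H t) = L ^ j * (L ^ (r - j) * L * K * [:\<Psi> t:])"
      using resolvent[of t] j unfolding G
      by (simp add: algebra_simps sum_distrib_left power_add[symmetric] flip: power_add power_Suc)
    then have H: "D' * ?H t = L ^ (r - j) * L * K * [:\<Psi> t:]" using L0 by (metis mult_left_cancel power_not_zero)
    have "poly D' c * poly (?H t) c = 0" using arg_cong[OF H, of "\<lambda>p. poly p c"] Lc by simp
    then have Hc: "poly (?H t) c = 0" using D'c by simp
    then show "(\<Sum>i\<in>{1..<m}. poly (G (transpose i m \<circ> t)) c) = c * poly (G t) c"
      by (simp add: u_def poly_sum)
    have "poly (pderiv (D' * ?H t)) c = poly D' c * poly (pderiv (?H t)) c"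
      using Hc by (simp only: pderiv_mult poly_add poly_mult) simp
    also have "poly (pderiv (?H t)) c = poly (G t) c + c * poly (pderiv (G t)) c
        - (\<Sum>i\<in>{1..<m}. poly (pderiv (G (transpose i m \<circ> t))) c)"
      by (simp del: comp_apply add: pderiv_diff pderiv_mult higher_pderiv_sum[of 1, simplified] poly_sum u_def pderiv_pCons)
    also have "poly (pderiv (D' * ?H t)) c = poly (L ^ (r - j)) c * poly K c * \<Psi> t"
      unfolding H by (simp add: pderiv_mult pderiv_smult Lc dL)
    also have "poly (L ^ (r - j)) c = (if j = r then 1 else 0)" using j Lc by (auto simp: poly_power)
    finally show "poly D' c * (poly (G t) c + c * poly (pderiv (G t)) c
        - (\<Sum>i\<in>{1..<m}. poly (pderiv (G (transpose i m \<circ> t))) c)) =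
      (if j = r then poly K c * \<Psi> t else 0)" by (auto split: if_splits simp del: comp_apply)
  qed
  have "\<exists>G. \<forall>t. F t = L ^ j * G t" if "j \<le> r" for j
    using that
  proof (induction j)
    case 0
    then show ?case by auto
  next
    case (Suc j)
    then obtain G where G: "\<And>t. F t = L ^ j * G t" by auto
    have j: "j \<le> r" "j \<noteq> r" using Suc.prems by auto
    \<comment> \<open>For j < r the value G(c) is in the kernel of c - x_m and equals c - x_m
      applied to minus the derivative of \<open>G\<close>.\<close>
    have zero: "poly (G t) c = 0" if t: "t permutes {1..n}" for t
    proof (rule left_regular_eigen_zero[OF m c_real _ _ t,
          where Z = "\<lambda>t. poly (G t) c" and Y = "\<lambda>t. - poly (pderiv (G t)) c"])
      show "poly (G g) c = c * - poly (pderiv (G g)) c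
          - (\<Sum>i\<in>{1..<m}. - poly (pderiv (G (transpose i m \<circ> g))) c)" for g
      proof -
        have "poly (G g) c + c * poly (pderiv (G g)) c
            - (\<Sum>i\<in>{1..<m}. poly (pderiv (G (transpose i m \<circ> g))) c) = 0"
          using eqs(2)[OF j(1) G, of g] j(2) D'c by (simp only: if_False mult_eq_0_iff simp_thms)
        then show ?thesis by (simp add: sum_negf algebra_simps del: comp_apply)
      qed
    qed (rule eqs(1)[OF j(1) G])
    have "L dvd G t" for t
    proof (cases "t permutes {1..n}")
      case True
      then show ?thesis using zero unfolding L_def by (simp add: poly_eq_0_iff_dvd)
    next
      case False
      then have "F t = 0" using F_supp perm_le[OF mn(1)] by blast
      then have "G t = 0" using G[of t] L0 by simp
      then show ?thesis by simp
    qed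
    then obtain G' where "\<And>t. G t = L * G' t" unfolding dvd_def by metis
    then show ?case using G by (auto simp: mult_ac)
  qed
  then obtain G where G: "\<And>t. F t = L ^ r * G t" by blast
  let ?W = "{w. w permutes {1..m - 1}}"
  \<comment> \<open>The multiple of \<open>\<Psi>\<close> left over at j = r. It cancels in
    \<open>G_conv\<close>, so its value never enters.\<close>
  define k where "k = poly K c / poly D' c"
  have G_eigen: "(\<Sum>i\<in>{1..<m}. poly (G (transpose i m \<circ> t)) c) = c * poly (G t) c" for t
    using eqs(1)[OF order_refl G] .
  have G_deriv: "poly (G t) c = k * \<Psi> t - (c * poly (pderiv (G t)) c
        - (\<Sum>i\<in>{1..<m}. poly (pderiv (G (transpose i m \<circ> t))) c))" for t
  proof -
    define b where "b = poly (G t) c + c * poly (pderiv (G t)) c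
        - (\<Sum>i\<in>{1..<m}. poly (pderiv (G (transpose i m \<circ> t))) c)"
    have "poly D' c * b = poly K c * \<Psi> t"
      using eqs(2)[OF order_refl G, of t] by (simp only: b_def simp_thms if_True)
    then have "b = k * \<Psi> t" using D'c by (simp add: k_def field_simps)
    then show ?thesis unfolding b_def by (simp add: algebra_simps del: comp_apply)
  qed
  \<comment> \<open>Convolution with \<open>\<Psi>\<close> commutes with left multiplications and
    multiplies \<open>\<Psi>\<close> itself by \<open>\<kappa>\<close>. Subtracting
    \<open>\<kappa>\<close> therefore removes the term k \<open>\<Psi>\<close>, and the difference
    \<open>Z\<close> is again both in the kernel and in the image of c - x_m.\<close>
  have G_conv: "(\<Sum>w\<in>?W. \<Psi> w * poly (G (t \<circ> inv w)) c) = \<kappa> * poly (G t) c" if t: "t permutes {1..n}" for t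
  proof -
    define P where "P t = poly (pderiv (G t)) c" for t
    define conv where "conv f t = (\<Sum>w\<in>?W. \<Psi> w * f (t \<circ> inv w))" for f :: "(nat \<Rightarrow> nat) \<Rightarrow> complex" and t
    define Z where "Z t = conv (\<lambda>t. poly (G t) c) t - \<kappa> * poly (G t) c" for t
    define Y where "Y t = \<kappa> * P t - conv P t" for t
    have conv_left: "(\<Sum>i\<in>{1..<m}. conv f (transpose i m \<circ> g)) = conv (\<lambda>t. \<Sum>i\<in>{1..<m}. f (transpose i m \<circ> t)) g"
      for f g
      unfolding conv_def sum_distrib_left comp_assoc by (rule sum.swap)
    have G_P: "poly (G t) c = k * \<Psi> t - (c * P t - (\<Sum>i\<in>{1..<m}. P (transpose i m \<circ> t)))" for t
      unfolding P_def by (rule G_deriv)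
    have conv_scale: "conv (\<lambda>t. r * f t) t = r * conv f t" for r f t
      by (simp add: conv_def sum_distrib_left mult.left_commute)
    have conv_diff: "conv (\<lambda>t. f t - f' t) t = conv f t - conv f' t" for f f' t
      by (simp add: conv_def right_diff_distrib sum_subtractf)
    have "Z t = 0"
    proof (rule left_regular_eigen_zero[where Z = Z and Y = Y, OF m c_real _ _ t])
      fix g
      define Q where "Q t = (\<Sum>i\<in>{1..<m}. P (transpose i m \<circ> t))" for t
      have conv_\<Psi>: "conv \<Psi> g = \<kappa> * \<Psi> g"
        unfolding conv_def \<Psi>_def \<kappa>_def by (rule matrix_coeff_convolution) (use mn in auto)
      have G_Q: "(\<lambda>t. poly (G t) c) = (\<lambda>t. k * \<Psi> t - (c * P t - Q t))"
        unfolding Q_def using G_P by (rule ext)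
      have "Z g = k * conv \<Psi> g - (c * conv P g - conv Q g) - \<kappa> * (k * \<Psi> g - (c * P g - Q g))"
        unfolding Z_def G_Q conv_diff conv_scale using fun_cong[OF G_Q, of g] by (simp only:)
      then have "Z g = c * Y g - (\<kappa> * Q g - conv Q g)"
        by (simp add: Y_def conv_\<Psi> algebra_simps)
      moreover have "(\<Sum>i\<in>{1..<m}. Y (transpose i m \<circ> g)) = \<kappa> * Q g - conv Q g"
        unfolding Y_def sum_subtractf conv_left Q_def sum_distrib_left ..
      ultimately show "Z g = c * Y g - (\<Sum>i\<in>{1..<m}. Y (transpose i m \<circ> g))"
        by (simp only:)
      show "(\<Sum>i\<in>{1..<m}. Z (transpose i m \<circ> g)) = c * Z g"
        unfolding Z_def sum_subtractf conv_left sum_distrib_left[symmetric] G_eigen conv_scale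
        by (simp add: algebra_simps)
    qed
    then show ?thesis by (simp add: Z_def conv_def)
  qed
  have "poly (G t) c = poly D' c * matrix_coeff m t" for t
  proof -
    define X where "X t = poly (G t) c - poly D' c * matrix_coeff m t" for t
    have "X t = 0"
    proof (rule eigen_zero[where X = X and \<kappa> = \<kappa>, OF m])
      fix t assume "X t \<noteq> 0"
      then have "F t \<noteq> 0 \<or> matrix_coeff m t \<noteq> 0" using G[of t] L0 by (auto simp: X_def)
      then show "t permutes {1..m}" using F_supp by (auto simp: matrix_coeff_def split: if_splits)
    next
      fix t assume t: "t permutes {1..<m}"
      have tm: "t permutes {1..m}" by (rule permutes_subset[OF t]) auto
      \<comment> \<open>On permutations fixing \<open>m\<close> only the transposition-free term of
        the product survives, and it contains all of \<open>D\<close>, so that L^r can be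
        cancelled.\<close>
      have "F t = D * [:\<Psi> t:]"
        unfolding F_def D_def pm[symmetric] \<Psi>_def
      proof (rule ascending_prod_support(2))
        show "s permutes {1..<m}" if "[:matrix_coeff (m - 1) s:] \<noteq> 0" for s
          using that supp_\<Psi> by (auto simp: \<Psi>_def)
      qed (use m permutes_not_in[OF t, of m] in auto)
      then have "L ^ r * G t = L ^ r * (D' * [:\<Psi> t:])" using G D by (simp only: mult.assoc)
      then have "G t = D' * [:\<Psi> t:]" using L0 by (metis mult_left_cancel power_not_zero)
      moreover have "\<Psi> t = matrix_coeff m t"
        using t tm pm by (simp add: \<Psi>_def matrix_coeff_def)
      ultimately show "X t = 0" by (simp add: X_def)
    next
      fix t assume "t permutes {1..n}"
      show "(\<Sum>i\<in>{1..<m}. X (transpose i m \<circ> t)) = cT m * X t"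
      proof -
        have "(\<Sum>i\<in>{1..<m}. matrix_coeff m (transpose i m \<circ> t)) = c * matrix_coeff m t"
          unfolding c_def by (rule matrix_coeff_eigen(2)) (use m in auto)
        then have "(\<Sum>i\<in>{1..<m}. X (transpose i m \<circ> t)) = c * poly (G t) c - poly D' c * (c * matrix_coeff m t)"
          unfolding X_def sum_subtractf sum_distrib_left[symmetric] G_eigen by (simp only:)
        then show ?thesis by (simp add: X_def c_def right_diff_distrib mult.left_commute)
      qed
    next
      fix t assume t: "t permutes {1..n}"
      have "(\<Sum>w\<in>?W. \<Psi> w * matrix_coeff m (t \<circ> inv w)) = \<kappa> * matrix_coeff m t"
        unfolding \<Psi>_def \<kappa>_def by (rule matrix_coeff_convolution) (use mn in auto)
      moreover have "(\<Sum>w\<in>?W. \<Psi> w * X (t \<circ> inv w)) = (\<Sum>w\<in>?W. \<Psi> w * poly (G (t \<circ> inv w)) c)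
          - poly D' c * (\<Sum>w\<in>?W. \<Psi> w * matrix_coeff m (t \<circ> inv w))"
        unfolding X_def right_diff_distrib sum_subtractf sum_distrib_left
        by (simp add: mult.left_commute)
      ultimately have "(\<Sum>w\<in>?W. \<Psi> w * X (t \<circ> inv w)) = \<kappa> * poly (G t) c - poly D' c * (\<kappa> * matrix_coeff m t)"
        using G_conv[OF t] by (simp only:)
      then show "(\<Sum>w\<in>?W. matrix_coeff (m - 1) w * X (t \<circ> inv w)) = \<kappa> * X t"
        unfolding \<Psi>_def by (simp add: X_def[of t] right_diff_distrib mult.left_commute)
    next
      show "\<kappa> \<noteq> 0" using coeff_norm_nonzero[OF mn(2)] by (simp add: \<kappa>_def)
    qed
    then show ?thesis by (simp add: X_def)
  qed
  then show thesis using that[of r D' G] D D'c G unfolding L_def c_def by blast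
qed

end

section \<open>Evaluation of rational functions\<close>

lemma rconst_0: "rconst 0 = 0"
  by (simp add: rconst_def fract_collapse)

lemma rconst_1: "rconst 1 = 1"
  by (simp add: rconst_def fract_collapse)

lemma rconst_add: "rconst (a + b) = rconst a + rconst b"
  by (simp add: rconst_def single_add)

lemma rconst_mult: "rconst (a * b) = rconst a * rconst b"
  by (simp add: rconst_def mult_single)

lemma rvar_neq:
  "i \<noteq> j \<Longrightarrow> rvar i - rvar j \<noteq> 0" "rconst a - rvar j \<noteq> 0"
proof -
  assume "i \<noteq> j"
  then have "Poly_Mapping.single i (1::nat) \<noteq> Poly_Mapping.single j 1"
    by (metis lookup_single_eq lookup_single_not_eq zero_neq_one)
  then have "Poly_Mapping.single (Poly_Mapping.single i (1::nat)) (1::complex) \<noteq>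
      Poly_Mapping.single (Poly_Mapping.single j 1) 1"
    by (metis lookup_single_eq lookup_single_not_eq zero_neq_one)
  then have "rvar i \<noteq> rvar j" unfolding rvar_def by (simp add: eq_fract)
  then show "rvar i - rvar j \<noteq> 0" by simp
next
  have "(0 :: nat \<Rightarrow>\<^sub>0 nat) \<noteq> Poly_Mapping.single j 1"
    by (metis lookup_single_eq lookup_zero zero_neq_one)
  then have "Poly_Mapping.single (0 :: nat \<Rightarrow>\<^sub>0 nat) a \<noteq> Poly_Mapping.single (Poly_Mapping.single j 1) 1"
    by (metis lookup_single_eq lookup_single_not_eq zero_neq_one)
  then have "rconst a \<noteq> rvar j" unfolding rconst_def rvar_def by (simp add: eq_fract)
  then show "rconst a - rvar j \<noteq> 0" by simp
qed

text \<open>Regularity and value in one relation. It is closed under the field operations, so both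
  are carried through a long expression together.\<close>

definition evaluates :: "nat \<Rightarrow> complex \<Rightarrow> ratfun \<Rightarrow> ratfun \<Rightarrow> bool" where
  "evaluates k c r w \<longleftrightarrow> (\<exists>p q. poly_subst k c q \<noteq> 0 \<and> r = Fract p q \<and>
     w = Fract (poly_subst k c p) (poly_subst k c q))"

lemma evaluates_regular: "evaluates k c r w \<Longrightarrow> regular_at k c r"
  by (auto simp: evaluates_def regular_at_def)

lemma evaluates_eval_at: "evaluates k c r w \<Longrightarrow> eval_at k c r = w"
  by (auto simp: evaluates_def eval_at_Fract)

lemma poly_subst_neq_zero: "poly_subst k c q \<noteq> 0 \<Longrightarrow> q \<noteq> 0"
  using poly_subst_zero by metis

lemma evaluates_add:
  assumes "evaluates k c r w" "evaluates k c r' w'"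
  shows "evaluates k c (r + r') (w + w')"
proof -
  obtain p q p' q' where *: "poly_subst k c q \<noteq> 0" "r = Fract p q"
      "w = Fract (poly_subst k c p) (poly_subst k c q)" "poly_subst k c q' \<noteq> 0" "r' = Fract p' q'"
      "w' = Fract (poly_subst k c p') (poly_subst k c q')"
    using assms unfolding evaluates_def by blast
  then have "q \<noteq> 0" "q' \<noteq> 0" using poly_subst_neq_zero by blast+
  then show ?thesis
    unfolding evaluates_def using *
    by (intro exI[of _ "p * q' + p' * q"] exI[of _ "q * q'"]) (simp add: poly_subst_mult poly_subst_add)
qed

lemma evaluates_mult:
  assumes "evaluates k c r w" "evaluates k c r' w'"
  shows "evaluates k c (r * r') (w * w')"
proof -
  obtain p q p' q' where *: "poly_subst k c q \<noteq> 0" "r = Fract p q"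
      "w = Fract (poly_subst k c p) (poly_subst k c q)" "poly_subst k c q' \<noteq> 0" "r' = Fract p' q'"
      "w' = Fract (poly_subst k c p') (poly_subst k c q')"
    using assms unfolding evaluates_def by blast
  then show ?thesis
    unfolding evaluates_def
    by (intro exI[of _ "p * p'"] exI[of _ "q * q'"]) (simp add: poly_subst_mult)
qed

lemma evaluates_inverse:
  assumes "evaluates k c r w" "w \<noteq> 0"
  shows "evaluates k c (inverse r) (inverse w)"
proof -
  obtain p q where *: "poly_subst k c q \<noteq> 0" "r = Fract p q"
      "w = Fract (poly_subst k c p) (poly_subst k c q)"
    using assms unfolding evaluates_def by blast
  have "poly_subst k c p \<noteq> 0" using * assms(2) by (auto simp: fract_collapse)
  then show ?thesis
    unfolding evaluates_def using * by (intro exI[of _ q] exI[of _ p]) simp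
qed

lemma update_zero: "Poly_Mapping.update k 0 (0 :: nat \<Rightarrow>\<^sub>0 nat) = 0"
  by (rule poly_mapping_eqI) (simp add: lookup_update)

lemma evaluates_polynomial: "evaluates k c (Fract p 1) (Fract (poly_subst k c p) 1)"
proof -
  have "poly_subst k c 1 = 1"
    using poly_subst_single[of k c 0 1] by (simp add: update_zero)
  then show ?thesis unfolding evaluates_def by (intro exI[of _ p] exI[of _ 1]) simp
qed

lemma evaluates_const: "evaluates k c (rconst a) (rconst a)"
  using evaluates_polynomial[of k c "Poly_Mapping.single 0 a"]
  by (simp add: rconst_def poly_subst_single update_zero)

lemma evaluates_var: "evaluates k c (rvar i) (if i = k then rconst c else rvar i)"
proof -
  have "Poly_Mapping.update k 0 (Poly_Mapping.single i (1::nat)) =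
      (if i = k then 0 else Poly_Mapping.single i 1)"
    by (rule poly_mapping_eqI) (simp add: lookup_update lookup_single when_def)
  then show ?thesis
    using evaluates_polynomial[of k c "Poly_Mapping.single (Poly_Mapping.single i 1) 1"]
    by (auto simp: rconst_def rvar_def poly_subst_single lookup_single)
qed

lemma evaluates_diff:
  assumes "evaluates k c r w" "evaluates k c r' w'"
  shows "evaluates k c (r - r') (w - w')"
proof -
  have "rconst (- 1) = - 1"
    using rconst_add[of 1 "- 1"] by (simp add: rconst_0 rconst_1 eq_neg_iff_add_eq_0 add.commute)
  then show ?thesis
    using evaluates_add[OF assms(1) evaluates_mult[OF evaluates_const[of k c "- 1"] assms(2)]] by simp
qed

lemma evaluates_divide:
  assumes "evaluates k c r w" "evaluates k c r' w'" "w' \<noteq> 0"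
  shows "evaluates k c (r / r') (w / w')"
  unfolding divide_inverse using assms by (intro evaluates_mult evaluates_inverse)

text \<open>Transports the computation of \<open>fusion_step\<close>, which lives in polynomials of
  one variable u, to rational functions by putting u_k for u.\<close>

definition poly_at :: "nat \<Rightarrow> complex poly \<Rightarrow> ratfun" where
  "poly_at k p = poly (map_poly rconst p) (rvar k)"

lemma poly_at_0: "poly_at k 0 = 0"
  by (simp add: poly_at_def)

lemma poly_at_pCons: "poly_at k (pCons a p) = rconst a + rvar k * poly_at k p"
  by (simp add: poly_at_def map_poly_pCons rconst_0)

lemma poly_at_add: "poly_at k (p + q) = poly_at k p + poly_at k q"
  by (induction p q rule: poly_induct2) (simp_all add: poly_at_0 poly_at_pCons rconst_add algebra_simps)

lemma poly_at_smult: "poly_at k (smult a p) = rconst a * poly_at k p"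
  by (induction p) (simp_all add: poly_at_0 poly_at_pCons rconst_mult algebra_simps)

lemma poly_at_mult: "poly_at k (p * q) = poly_at k p * poly_at k q"
  by (induction p) (simp_all add: poly_at_0 poly_at_pCons poly_at_add poly_at_smult rconst_0 algebra_simps)

lemma poly_at_const: "poly_at k [:a:] = rconst a"
  by (simp add: poly_at_0 poly_at_pCons)

lemma poly_at_linear: "poly_at k [:- a, 1:] = rvar k - rconst a"
proof -
  have "rconst (- a) + rconst a = 0" using rconst_add[of "- a" a] by (simp add: rconst_0)
  then show ?thesis
    by (simp add: poly_at_0 poly_at_pCons rconst_1 eq_diff_eq' algebra_simps)
qed

lemma evaluates_poly_at: "evaluates k c (poly_at k p) (rconst (poly p c))"
proof (induction p)
  case 0
  show ?case using evaluates_const[of k c 0] by (simp add: poly_at_0 rconst_0)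
next
  case (pCons a p)
  show ?case
    using evaluates_add[OF evaluates_const[of k c a] evaluates_mult[OF evaluates_var[of k c k] pCons.IH]]
    by (simp add: poly_at_pCons rconst_add rconst_mult)
qed

lemma rconst_eq_0_iff: "rconst a = 0 \<longleftrightarrow> a = 0"
proof
  assume "rconst a = 0"
  then have "Poly_Mapping.single (0 :: nat \<Rightarrow>\<^sub>0 nat) a = 0" by (simp add: rconst_def Zero_fract_def eq_fract)
  then show "a = 0" by (metis lookup_single_eq lookup_zero)
qed (simp add: rconst_0)

text \<open>A point \<open>c\<close> where \<open>p\<close> does not vanish witnesses this: if
  \<open>poly_at k p\<close> were 0, its value at \<open>c\<close> would be both 0 and
  \<open>rconst (poly p c)\<close>.\<close>

lemma poly_at_neq_0: "poly p c \<noteq> 0 \<Longrightarrow> poly_at k p \<noteq> 0"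
  using evaluates_eval_at[OF evaluates_poly_at[of k c p]] evaluates_eval_at[OF evaluates_const[of k c 0]]
  by (metis rconst_0 rconst_eq_0_iff)

section \<open>The fusion product\<close>

lemma ga_mult_eq:
  "ga_mult n f g s = (if s permutes {1..n} then \<Sum>b | b permutes {1..n}. f (s \<circ> inv b) * g b else 0)"
proof (cases "s permutes {1..n}")
  case True
  have "ga_mult n f g s = (\<Sum>b | b permutes {1..n}. f (s \<circ> inv b) * g b)"
    unfolding ga_mult_def
    by (rule sum.reindex_bij_witness[where i = "\<lambda>b. (s \<circ> inv b, b)" and j = snd])
      (auto simp: comp_assoc permutes_inv_o permutes_compose[OF permutes_inv True, unfolded One_nat_def])
  then show ?thesis using True by simp
next
  case False
  then have e: "{(a, b). a permutes {1..n} \<and> b permutes {1..n} \<and> a \<circ> b = s} = {}"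
    using permutes_compose by blast
  show ?thesis unfolding ga_mult_def e using False by simp
qed

lemma ga_mult_assoc: "ga_mult n f (ga_mult n g h) = ga_mult n (ga_mult n f g) h"
proof
  fix s
  show "ga_mult n f (ga_mult n g h) s = ga_mult n (ga_mult n f g) h s"
  proof (cases "s permutes {1..n}")
    case True
    let ?P = "{b. b permutes {1..n}}"
    have shift: "(\<Sum>b\<in>?P. f (s \<circ> inv b) * g (b \<circ> inv d)) = (\<Sum>b\<in>?P. f (s \<circ> inv d \<circ> inv b) * g b)"
      if d: "d permutes {1..n}" for d
    proof (rule sum.reindex_bij_witness[where i = "\<lambda>b. b \<circ> d" and j = "\<lambda>b. b \<circ> inv d"])
      fix b assume "b \<in> ?P"
      then have b: "b permutes {1..n}" by simp
      show "b \<circ> inv d \<circ> d = b" "b \<circ> d \<circ> inv d = b" by (simp_all add: comp_assoc permutes_inv_o[OF d])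
      show "b \<circ> inv d \<in> ?P" "b \<circ> d \<in> ?P"
        using permutes_compose[OF permutes_inv[OF d] b] permutes_compose[OF d b] by auto
      have "inv (b \<circ> inv d) = d \<circ> inv b"
        using o_inv_distrib[OF permutes_bij[OF b] permutes_bij[OF permutes_inv[OF d]]]
        by (simp add: permutes_inv_inv[OF d])
      moreover have "s \<circ> inv d \<circ> (d \<circ> inv b) = s \<circ> inv b"
        by (metis comp_assoc comp_id permutes_inv_o(2)[OF d])
      ultimately show "f (s \<circ> inv d \<circ> inv (b \<circ> inv d)) * g (b \<circ> inv d) = f (s \<circ> inv b) * g (b \<circ> inv d)"
        by simp
    qed
    have sp: "s \<circ> inv d permutes {1..n}" if "d permutes {1..n}" for d
      using permutes_compose[OF permutes_inv[OF that] True] .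
    have "ga_mult n f (ga_mult n g h) s = (\<Sum>b\<in>?P. f (s \<circ> inv b) * (\<Sum>d\<in>?P. g (b \<circ> inv d) * h d))"
      using True unfolding ga_mult_eq by (auto intro!: sum.cong)
    also have "\<dots> = (\<Sum>d\<in>?P. \<Sum>b\<in>?P. f (s \<circ> inv b) * g (b \<circ> inv d) * h d)"
      unfolding sum_distrib_left by (subst sum.swap) (simp add: mult.assoc)
    also have "\<dots> = (\<Sum>d\<in>?P. (\<Sum>b\<in>?P. f (s \<circ> inv d \<circ> inv b) * g b) * h d)"
      unfolding sum_distrib_right[symmetric] by (rule sum.cong) (simp_all only: mem_Collect_eq shift)
    also have "\<dots> = ga_mult n (ga_mult n f g) h s"
      using True sp unfolding ga_mult_eq by (auto intro!: sum.cong)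
    finally show ?thesis .
  qed (simp add: ga_mult_eq)
qed

section \<open>The ordered product as successive right multiplications\<close>

definition supported :: "nat \<Rightarrow> 'a::comm_ring_1 group_alg \<Rightarrow> bool" where
  "supported n F \<longleftrightarrow> (\<forall>s. F s \<noteq> 0 \<longrightarrow> s permutes {1..n})"

text \<open>Right multiplication by 1 - (i j)/(a_i - u_j). Only the first index goes through the
  assignment \<open>a\<close>: the factors that remain after k evaluations have j > k, so u_j is
  still free, while u_i may already be a number.\<close>

definition apply_factor :: "(nat \<Rightarrow> ratfun) \<Rightarrow> nat \<times> nat \<Rightarrow> ratfun group_alg \<Rightarrow> ratfun group_alg" where
  "apply_factor a = (\<lambda>(i, j) F s. F s - 1 / (a i - rvar j) * F (s \<circ> transpose i j))"

definition apply_factors :: "(nat \<Rightarrow> ratfun) \<Rightarrow> (nat \<times> nat) list \<Rightarrow> ratfun group_alg \<Rightarrow> ratfun group_alg" where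
  "apply_factors a xs F = foldl (\<lambda>F x. apply_factor a x F) F xs"

lemma apply_factors_simps:
  "apply_factors a [] F = F"
  "apply_factors a (x # xs) F = apply_factors a xs (apply_factor a x F)"
  "apply_factors a (xs @ ys) F = apply_factors a ys (apply_factors a xs F)"
  by (simp_all add: apply_factors_def)

definition factor_indices :: "nat \<Rightarrow> nat \<Rightarrow> (nat \<times> nat) list" where
  "factor_indices k n = concat (map (\<lambda>j. map (\<lambda>i. (i, j)) [1..<j]) [k..<n])"

lemma factor_indices_rec:
  "k < n \<Longrightarrow> factor_indices k n = map (\<lambda>i. (i, k)) [1..<k] @ factor_indices (Suc k) n"
  by (simp add: factor_indices_def upt_conv_Cons)

lemma set_factor_indices: "set (factor_indices k n) = {(i, j). k \<le> j \<and> j < n \<and> 1 \<le> i \<and> i < j}"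
  by (auto simp: factor_indices_def)

lemma ga_mult_fusion_factor:
  assumes F: "supported n F" and ij: "i \<in> {1..n}" "j \<in> {1..n}" "i \<noteq> j"
  shows "ga_mult n F (fusion_factor i j) = apply_factor rvar (i, j) F"
proof
  fix s
  let ?t = "transpose i j"
  have t: "?t permutes {1..n}" using ij by (intro permutes_swap_id)
  have ne: "?t \<noteq> id" using ij(3) by (metis id_apply transpose_apply_first)
  show "ga_mult n F (fusion_factor i j) s = apply_factor rvar (i, j) F s"
  proof (cases "s permutes {1..n}")
    case True
    let ?P = "{b. b permutes {1..n}}"
    have fin: "finite ?P" by (simp add: finite_permutations)
    have "F (s \<circ> inv b) * fusion_factor i j b = (if b = id then F s else 0)
        - 1 / (rvar i - rvar j) * (if b = ?t then F (s \<circ> ?t) else 0)" for b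
      using ne by (auto simp: fusion_factor_def ga_basis_def)
    then have "ga_mult n F (fusion_factor i j) s =
        (\<Sum>b\<in>?P. if b = id then F s else 0)
        - 1 / (rvar i - rvar j) * (\<Sum>b\<in>?P. if b = ?t then F (s \<circ> ?t) else 0)"
      using True by (simp only: ga_mult_eq sum_subtractf sum_distrib_left if_True)
    then show ?thesis
      using fin t by (simp add: apply_factor_def permutes_id)
  next
    case False
    have "s = (s \<circ> ?t) \<circ> ?t" by (simp add: comp_assoc)
    then have "\<not> (s \<circ> ?t) permutes {1..n}" using False permutes_compose[OF t] by metis
    then have "F (s \<circ> ?t) = 0" "F s = 0" using F False by (auto simp: supported_def)
    then show ?thesis using False by (simp add: ga_mult_eq apply_factor_def)
  qed
qed

lemma supported_ga_mult: "supported n (ga_mult n F G)"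
  by (simp add: supported_def ga_mult_eq)

text \<open>The list product is folded from the right, the evaluation needs the factors applied from
  the left; associativity, with an accumulated left factor \<open>F\<close>, passes from one to the
  other.\<close>

lemma ga_prod_list_fusion_factors:
  assumes "\<forall>(i, j) \<in> set xs. i \<in> {1..n} \<and> j \<in> {1..n} \<and> i \<noteq> j"
  shows "ga_prod_list n (map (\<lambda>(i, j). fusion_factor i j) xs) = apply_factors rvar xs (ga_basis id)"
proof -
  have main: "ga_mult n F (ga_prod_list n (map (\<lambda>(i, j). fusion_factor i j) xs)) = apply_factors rvar xs F"
    if "supported n F" "\<forall>(i, j) \<in> set xs. i \<in> {1..n} \<and> j \<in> {1..n} \<and> i \<noteq> j" for F xs
    using that
  proof (induction xs arbitrary: F)
    case Nil
    have "ga_mult n F (ga_basis id) s = F s" for s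
    proof -
      have "(\<Sum>b | b permutes {1..n}. F (s \<circ> inv b) * ga_basis id b) =
          (\<Sum>b | b permutes {1..n}. if b = id then F s else 0)"
        by (rule sum.cong) (auto simp: ga_basis_def)
      then show ?thesis
        using Nil(1) by (auto simp: ga_mult_eq supported_def finite_permutations permutes_id)
    qed
    then show ?case by (simp add: ga_prod_list_def apply_factors_simps fun_eq_iff)
  next
    case (Cons x xs)
    obtain i j where x: "x = (i, j)" by force
    have e: "ga_mult n F (fusion_factor i j) = apply_factor rvar x F"
      using ga_mult_fusion_factor Cons.prems x by auto
    have "ga_mult n (ga_mult n F (fusion_factor i j)) (ga_prod_list n (map (\<lambda>(i, j). fusion_factor i j) xs)) =
        apply_factors rvar xs (ga_mult n F (fusion_factor i j))"
      by (rule Cons.IH[OF supported_ga_mult]) (use Cons.prems(2) in auto)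
    then show ?case
      by (simp add: ga_prod_list_def ga_mult_assoc apply_factors_simps x e[unfolded x])
  qed
  \<comment> \<open>The list product has no left factor to start from, so for a nonempty list its
    first factor is taken as \<open>F\<close> in \<open>main\<close>.\<close>
  show ?thesis
  proof (cases xs)
    case Nil
    then show ?thesis by (simp add: ga_prod_list_def apply_factors_simps)
  next
    case (Cons x ys)
    obtain i j where x: "x = (i, j)" by force
    have ij: "i \<in> {1..n}" "j \<in> {1..n}" using assms Cons x by auto
    have eq: "fusion_factor i j = apply_factor rvar x (ga_basis id)"
    proof
      fix s
      have "s \<circ> transpose i j = id \<longleftrightarrow> s = transpose i j"
        by (metis comp_assoc comp_id id_comp transpose_comp_involutory)
      then show "fusion_factor i j s = apply_factor rvar x (ga_basis id) s"
        by (simp add: x fusion_factor_def apply_factor_def ga_basis_def)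
    qed
    have "supported n (fusion_factor i j)"
      using ij permutes_swap_id[OF ij]
      by (auto simp: supported_def fusion_factor_def ga_basis_def permutes_id split: if_splits)
    then show ?thesis
      using main[of "fusion_factor i j" ys] assms Cons x eq
      by (simp add: ga_prod_list_def apply_factors_simps)
  qed
qed

lemma fusion_product_eq:
  "fusion_product n = apply_factors rvar (factor_indices 1 (n + 1)) (ga_basis id)"
proof -
  have "[fusion_factor i j. j \<leftarrow> [1..<n + 1], i \<leftarrow> [1..<j]] =
      map (\<lambda>(i, j). fusion_factor i j) (factor_indices 1 (n + 1))"
    by (simp add: factor_indices_def map_concat comp_def)
  then show ?thesis
    unfolding fusion_product_def
    using ga_prod_list_fusion_factors[of "factor_indices 1 (n + 1)" n]
    by (auto simp: set_factor_indices)
qed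

section \<open>Factors with some of the variables already evaluated\<close>

definition partial_vars :: "(nat \<Rightarrow> complex) \<Rightarrow> nat \<Rightarrow> nat \<Rightarrow> ratfun" where
  "partial_vars c k i = (if 1 \<le> i \<and> i \<le> k then rconst (c i) else rvar i)"

lemma evaluates_partial_vars:
  "evaluates (Suc k) (c (Suc k)) (partial_vars c k i) (partial_vars c (Suc k) i)"
  using evaluates_var[of "Suc k" "c (Suc k)" i] evaluates_const[of "Suc k" "c (Suc k)" "c i"]
  by (auto simp: partial_vars_def le_Suc_eq split: if_splits)

text \<open>For j > k + 1 the variable u_j survives the substitution, so the denominator remains
  nonzero whatever becomes of u_i. These factors create no pole, and the evaluation passes through
  them.\<close>

lemma evaluates_apply_factors:
  assumes "\<And>s. evaluates (Suc k) (c (Suc k)) (F s) (W s)"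
    and "\<forall>(i, j) \<in> set xs. Suc k < j \<and> i < j"
  shows "evaluates (Suc k) (c (Suc k)) (apply_factors (partial_vars c k) xs F s)
    (apply_factors (partial_vars c (Suc k)) xs W s)"
  using assms
proof (induction xs arbitrary: F W)
  case (Cons x xs)
  obtain i j where x: "x = (i, j)" by force
  have j: "Suc k < j" "i < j" using Cons.prems(2) x by auto
  have ne: "partial_vars c (Suc k) i - rvar j \<noteq> 0"
    using rvar_neq j by (auto simp: partial_vars_def)
  have "evaluates (Suc k) (c (Suc k)) (rvar j) (rvar j)"
    using evaluates_var[of "Suc k" "c (Suc k)" j] j by simp
  then have "evaluates (Suc k) (c (Suc k)) (1 / (partial_vars c k i - rvar j))
      (1 / (partial_vars c (Suc k) i - rvar j))"
    using evaluates_const[of "Suc k" "c (Suc k)" 1] ne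
    by (intro evaluates_divide evaluates_diff evaluates_partial_vars) (auto simp: rconst_1)
  then have "evaluates (Suc k) (c (Suc k)) (apply_factor (partial_vars c k) x F s)
      (apply_factor (partial_vars c (Suc k)) x W s)" for s
    unfolding apply_factor_def x prod.case
    by (intro evaluates_diff evaluates_mult Cons.prems(1))
  then show ?case
    using Cons.IH Cons.prems(2) by (simp add: apply_factors_simps)
qed (simp add: apply_factors_simps)

text \<open>Each factor 1 - (i m)/(c_i - u_m) equals ((u_m - c_i) + (i m))/(u_m - c_i), which
  accounts for the plus sign in \<open>ascending_factor\<close> and for the common
  denominator.\<close>

lemma apply_factors_ascending_prod:
  fixes c :: "nat \<Rightarrow> complex"
  assumes "l < m" "l \<le> k" and F: "\<And>s. F s = poly_at m (A s)"
  defines "u \<equiv> [:0, 1:]" and "a \<equiv> \<lambda>i. [:c i:]"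
  shows "apply_factors (partial_vars c k) (map (\<lambda>i. (i, m)) [1..<Suc l]) F =
    (\<lambda>s. poly_at m (ascending_prod u a m l A s) / poly_at m (\<Prod>i\<in>{1..l}. u - a i))"
  using assms(1,2)
proof (induction l)
  case 0
  have "poly_at m 1 = 1" using poly_at_const[of m 1] by (simp add: rconst_1 one_pCons)
  then show ?case by (simp add: apply_factors_simps F)
next
  case (Suc l)
  let ?d = "rvar m - rconst (c (Suc l))" and ?D = "\<Prod>i\<in>{1..l}. u - a i"
  have d: "?d \<noteq> 0" using rvar_neq(2)[of "c (Suc l)" m] by (metis eq_iff_diff_eq_0)
  have ua: "poly_at m (u - a (Suc l)) = ?d"
    using poly_at_linear[of m "c (Suc l)"] by (simp add: u_def a_def)
  have s1: "{1..Suc l} = insert (Suc l) {1..l}" by auto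
  have up: "[1..<Suc (Suc l)] = [1..<Suc l] @ [Suc l]" by simp
  have IH: "apply_factors (partial_vars c k) (map (\<lambda>i. (i, m)) [1..<Suc l]) F =
    (\<lambda>s. poly_at m (ascending_prod u a m l A s) / poly_at m ?D)"
    using Suc by simp
  show ?case
  proof
    fix s
    let ?M = "ascending_prod u a m l A"
    have "apply_factors (partial_vars c k) (map (\<lambda>i. (i, m)) [1..<Suc (Suc l)]) F s =
        poly_at m (?M s) / poly_at m ?D
         - 1 / (rconst (c (Suc l)) - rvar m) * (poly_at m (?M (s \<circ> transpose (Suc l) m)) / poly_at m ?D)"
      using Suc.prems unfolding up map_append apply_factors_simps IH
      by (simp add: apply_factors_simps apply_factor_def partial_vars_def)
    also have "1 / (rconst (c (Suc l)) - rvar m) = - (1 / ?d)"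
      by (metis minus_diff_eq divide_minus_right)
    also have "poly_at m (?M s) / poly_at m ?D
         - (- (1 / ?d)) * (poly_at m (?M (s \<circ> transpose (Suc l) m)) / poly_at m ?D) =
        (?d * poly_at m (?M s) + poly_at m (?M (s \<circ> transpose (Suc l) m))) / (?d * poly_at m ?D)"
      \<comment> \<open>If the accumulated denominator is 0, both sides are 0 by the convention for
        division by zero.\<close>
      using d by (cases "poly_at m ?D = 0") (simp_all add: field_simps)
    also have "\<dots> = poly_at m (ascending_prod u a m (Suc l) A s) / poly_at m (\<Prod>i\<in>{1..Suc l}. u - a i)"
      unfolding s1 by (simp add: ascending_factor_def poly_at_add poly_at_mult ua)
    finally show "apply_factors (partial_vars c k) (map (\<lambda>i. (i, m)) [1..<Suc (Suc l)]) F s =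
      poly_at m (ascending_prod u a m (Suc l) A s) / poly_at m (\<Prod>i\<in>{1..Suc l}. u - a i)" .
  qed
qed

text \<open>The factors with second index \<open>Suc k\<close> come first;
  \<open>fusion_step\<close> cancels their possible pole and gives the value M_(k+1). The later
  factors are regular and follow by \<open>evaluates_apply_factors\<close>.\<close>

lemma (in young_vector) evaluates_step:
  assumes "k < n"
  shows "evaluates (Suc k) (cT (Suc k))
    (apply_factors (partial_vars cT k) (factor_indices (Suc k) (n + 1)) (\<lambda>t. rconst (matrix_coeff k t)) s)
    (apply_factors (partial_vars cT (Suc k)) (factor_indices (Suc (Suc k)) (n + 1))
      (\<lambda>t. rconst (matrix_coeff (Suc k) t)) s)"
proof -
  let ?m = "Suc k" and ?c = "cT (Suc k)"
  let ?u = "[:0, 1:]" and ?a = "\<lambda>i. [:cT i:]"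
  let ?F = "ascending_prod ?u ?a ?m k (\<lambda>t. [:matrix_coeff k t:])"
  have m: "?m \<in> {1..n}" using assms by simp
  obtain r D' G where D: "(\<Prod>i\<in>{1..<?m}. ?u - ?a i) = [:- ?c, 1:] ^ r * D'" and D': "poly D' ?c \<noteq> 0"
    and F: "\<And>t. ?F t = [:- ?c, 1:] ^ r * G t"
    and G: "\<And>t. poly (G t) ?c = poly D' ?c * matrix_coeff ?m t"
    using fusion_step[OF m] by (metis diff_Suc_1)
  \<comment> \<open>The point c + 1 serves as witness because the linear factor has the value 1
    there.\<close>
  have L: "poly_at ?m ([:- ?c, 1:] ^ r) \<noteq> 0"
    by (rule poly_at_neq_0[of _ "?c + 1"]) (simp add: poly_power)
  have "evaluates ?m ?c (apply_factors (partial_vars cT k) (map (\<lambda>i. (i, ?m)) [1..<?m])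
      (\<lambda>t. rconst (matrix_coeff k t)) t) (rconst (matrix_coeff ?m t))" for t
  proof -
    have "apply_factors (partial_vars cT k) (map (\<lambda>i. (i, ?m)) [1..<?m])
        (\<lambda>t. rconst (matrix_coeff k t)) t = poly_at ?m (?F t) / poly_at ?m (\<Prod>i\<in>{1..k}. ?u - ?a i)"
      by (subst apply_factors_ascending_prod[of k ?m k _ "\<lambda>t. [:matrix_coeff k t:]"])
        (simp_all only: poly_at_const lessI order_refl)
    also have "\<dots> = poly_at ?m (G t) / poly_at ?m D'"
      using D L by (simp add: F poly_at_mult atLeastLessThanSuc_atLeastAtMost)
    finally have e: "apply_factors (partial_vars cT k) (map (\<lambda>i. (i, ?m)) [1..<?m])
        (\<lambda>t. rconst (matrix_coeff k t)) t = poly_at ?m (G t) / poly_at ?m D'" .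
    have ne: "rconst (poly D' ?c) \<noteq> 0" using D' by (simp add: rconst_eq_0_iff)
    have "evaluates ?m ?c (poly_at ?m (G t) / poly_at ?m D') (rconst (poly (G t) ?c) / rconst (poly D' ?c))"
      by (intro evaluates_divide evaluates_poly_at ne)
    then show ?thesis unfolding e using ne by (simp add: G rconst_mult)
  qed
  then have "evaluates ?m ?c
      (apply_factors (partial_vars cT k) (factor_indices (Suc ?m) (n + 1))
        (apply_factors (partial_vars cT k) (map (\<lambda>i. (i, ?m)) [1..<?m]) (\<lambda>t. rconst (matrix_coeff k t))) s)
      (apply_factors (partial_vars cT ?m) (factor_indices (Suc ?m) (n + 1))
        (\<lambda>t. rconst (matrix_coeff ?m t)) s)"
    by (rule evaluates_apply_factors) (auto simp: set_factor_indices)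
  moreover have "factor_indices ?m (n + 1) = map (\<lambda>i. (i, ?m)) [1..<?m] @ factor_indices (Suc ?m) (n + 1)"
    using assms by (intro factor_indices_rec) simp
  ultimately show ?thesis by (simp only: apply_factors_simps)
qed

theorem mainTheorem1:
  fixes n :: nat
    and lam :: "nat list"
    and T :: "nat \<times> nat \<Rightarrow> nat"
    and scale :: "complex \<Rightarrow> 'v::ab_group_add \<Rightarrow> 'v"
    and V :: "'v set"
    and act :: "(nat \<Rightarrow> nat) \<Rightarrow> 'v \<Rightarrow> 'v"
    and ip :: "'v \<Rightarrow> 'v \<Rightarrow> complex"
    and v :: "(nat \<times> nat \<Rightarrow> nat) \<Rightarrow> 'v"
    and c :: "nat \<Rightarrow> complex"
  assumes "n \<ge> 1"
    and "partition_of n lam"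
    and "standard_tableau lam T"
    and "young_rep scale n V act ip lam v"
    and "\<And>i. i \<in> {1..n} \<Longrightarrow> c i = of_int (content lam T i)"
  shows "consecutive_eval_well_defined n c (fusion_product n) \<and>
         consecutive_eval c (fusion_product n) n =
           (\<lambda>s. rconst (matrix_element n act ip (v T) s))"
proof -
  interpret young_vector scale n V act ip lam v T
    using assms(3,4) by (simp add: young_vector_def young_vector_axioms_def)
  have c: "c i = cT i" if "i \<in> {1..n}" for i
    using assms(5) that by (simp add: cT_def)
  have eval: "consecutive_eval c (fusion_product n) k =
      apply_factors (partial_vars cT k) (factor_indices (Suc k) (n + 1)) (\<lambda>t. rconst (matrix_coeff k t))"
    if "k \<le> n" for k
    using that
  proof (induction k)
    case 0
    have "(\<lambda>t. rconst (matrix_coeff 0 t)) = ga_basis id"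
      by (auto simp: matrix_coeff_zero ga_basis_def rconst_0 rconst_1)
    moreover have "partial_vars cT 0 = rvar" by (auto simp: partial_vars_def)
    ultimately show ?case by (simp add: fusion_product_eq)
  next
    case (Suc k)
    then show ?case
      using evaluates_eval_at[OF evaluates_step[of k]] c[of "Suc k"] by (simp add: ga_eval_at_def)
  qed
  have "ga_regular_at k (c k) (consecutive_eval c (fusion_product n) (k - 1))" if "k \<in> {1..n}" for k
  proof -
    have k: "k - 1 < n" "Suc (k - 1) = k" using that by auto
    show ?thesis
      using evaluates_regular[OF evaluates_step[OF k(1)], unfolded k(2)]
      unfolding ga_regular_at_def c[OF that] eval[OF less_imp_le[OF k(1)]] k(2) by blast
  qed
  \<comment> \<open>At k = n the list of remaining factors is empty, and the invariant
    \<open>eval\<close> leaves M_n alone.\<close>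
  moreover have "consecutive_eval c (fusion_product n) n = (\<lambda>s. rconst (matrix_element n act ip (v T) s))"
    by (simp add: eval matrix_element_eq factor_indices_def apply_factors_simps)
  ultimately show ?thesis
    by (auto simp: consecutive_eval_well_defined_def)
qed

end
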